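(* Let $PV_3$ be the group with generators $\lambda_{12},\lambda_{21},\lambda_{13},\lambda_{31},\lambda_{23},\lambda_{32}$ and the six defining relations $\lambda_{ki}\lambda_{kj}\lambda_{ij}=\lambda_{ij}\lambda_{kj}\lambda_{ki}$ for every ordering $(k,i,j)$ of the three distinct indices $1,2,3$. Then $PV_3$ is residually torsion-free nilpotent.
   Context: $PV_3$ is the pure virtual braid group on three strands; the presentation above may be taken as its definition. A group $G$ is residually torsion-free nilpotent if for every $1\neq g\in G$ there is a normal subgroup $N$ with $g\notin N$ and $G/N$ torsion-free nilpotent. *)

theory Defs
  imports "HOL-Algebra.Algebra"
begin

datatype idx = I1 | I2 | I3

datatype gen = L12 | L21 | L13 | L31 | L23 | L32

text \<open>lam k i is the generator lambda_{ki} (only used for k distinct from i).\<close>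
fun lam :: "idx \<Rightarrow> idx \<Rightarrow> gen" where
  "lam I1 I2 = L12" | "lam I2 I1 = L21" | "lam I1 I3 = L13"
| "lam I3 I1 = L31" | "lam I2 I3 = L23" | "lam I3 I2 = L32"
| "lam I1 I1 = L12" | "lam I2 I2 = L12" | "lam I3 I3 = L12"

text \<open>Letters of words in the free group: (g, False) is g, (g, True) is g inverse.\<close>
type_synonym letter = "gen \<times> bool"

definition inv_letter :: "letter \<Rightarrow> letter" where
  "inv_letter x = (fst x, \<not> snd x)"

definition pos :: "gen \<Rightarrow> letter" where
  "pos g = (g, False)"

inductive pv3_eq :: "letter list \<Rightarrow> letter list \<Rightarrow> bool" where
  refl: "pv3_eq w w"
| sym: "pv3_eq u v \<Longrightarrow> pv3_eq v u"
| trans: "pv3_eq u v \<Longrightarrow> pv3_eq v w \<Longrightarrow> pv3_eq u w"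
| cancel: "pv3_eq (u @ [x, inv_letter x] @ v) (u @ v)"
| rel: "distinct [k, i, j] \<Longrightarrow>
        pv3_eq (u @ [pos (lam k i), pos (lam k j), pos (lam i j)] @ v)
               (u @ [pos (lam i j), pos (lam k j), pos (lam k i)] @ v)"

definition pv3_rel :: "(letter list \<times> letter list) set" where
  "pv3_rel = {(u, v). pv3_eq u v}"

definition PV3 :: "letter list set monoid" where
  "PV3 = \<lparr> carrier = UNIV // pv3_rel,
           monoid.mult = (\<lambda>A B. pv3_rel `` {(SOME a. a \<in> A) @ (SOME b. b \<in> B)}),
           one = pv3_rel `` {[]} \<rparr>"

definition commutator :: "('a, 'b) monoid_scheme \<Rightarrow> 'a \<Rightarrow> 'a \<Rightarrow> 'a" where
  "commutator G x y = x \<otimes>\<^bsub>G\<^esub> y \<otimes>\<^bsub>G\<^esub> inv\<^bsub>G\<^esub> x \<otimes>\<^bsub>G\<^esub> inv\<^bsub>G\<^esub> y"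

text \<open>Lower central series: gamma_1 = G, gamma_{n+1} = [gamma_n, G] (index shifted by one).\<close>
fun lower_central :: "('a, 'b) monoid_scheme \<Rightarrow> nat \<Rightarrow> 'a set" where
  "lower_central G 0 = carrier G"
| "lower_central G (Suc n) =
     generate G {commutator G x y | x y. x \<in> lower_central G n \<and> y \<in> carrier G}"

definition nilpotent_group :: "('a, 'b) monoid_scheme \<Rightarrow> bool" where
  "nilpotent_group G \<longleftrightarrow> group G \<and> (\<exists>n. lower_central G n = {\<one>\<^bsub>G\<^esub>})"

definition torsion_free :: "('a, 'b) monoid_scheme \<Rightarrow> bool" where
  "torsion_free G \<longleftrightarrow>
     (\<forall>x \<in> carrier G. \<forall>n::nat. n > 0 \<longrightarrow> x [^]\<^bsub>G\<^esub> n = \<one>\<^bsub>G\<^esub> \<longrightarrow> x = \<one>\<^bsub>G\<^esub>)"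

definition residually_tf_nilpotent :: "('a, 'b) monoid_scheme \<Rightarrow> bool" where
  "residually_tf_nilpotent G \<longleftrightarrow>
     (\<forall>g \<in> carrier G. g \<noteq> \<one>\<^bsub>G\<^esub> \<longrightarrow>
        (\<exists>N. N \<lhd> G \<and> g \<notin> N \<and> nilpotent_group (G Mod N) \<and> torsion_free (G Mod N)))"

end

theory Submission
  imports Defs
begin

text \<open>
  Put \<open>x = \<lambda>12\<close>, \<open>a = \<lambda>12 \<lambda>13\<close>, \<open>b = \<lambda>23 \<lambda>21\<close>, \<open>c = \<lambda>31 \<lambda>32\<close>, \<open>s\<close> the inverse of
  \<open>\<lambda>23 \<lambda>13\<close> and \<open>t\<close> the inverse of \<open>\<lambda>31 \<lambda>21\<close>. Each relation \<open>u v w = w v u\<close> says that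
  \<open>u v\<close> commutes with \<open>w v\<close>, and the six relations become those of the free product of
  \<open>\<langle>x\<rangle>\<close> with a semidirect product of the free groups \<open>F(a, b, c)\<close> and \<open>F(s, t)\<close>, where \<open>s\<close> fixes
  \<open>a\<close>, \<open>b\<close> and conjugates \<open>c\<close> by \<open>a b\<close>, while \<open>t\<close> fixes \<open>b\<close>, \<open>c\<close> and conjugates \<open>a\<close> by \<open>b c\<close>.

  A group is residually torsion-free nilpotent as soon as its integer-valued polynomial functions
  (those killed by iterated left differences) separate each nontrivial element from the identity:
  the elements acting trivially on all polynomial functions modulo lower degree, to a given depth,
  form a central series with torsion-free factors. Polynomial functions extend from the factors
  of the semidirect product because the action on the abelianization of \<open>F(a, b, c)\<close> is trivial, and
  from \<open>G\<close> to the free product of \<open>G\<close> and a free group by a Magnus expansion with coefficients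
  in the polynomial functions on \<open>G\<close>.
\<close>

section \<open>Polynomial functions on a group\<close>

text \<open>Groups are instances of \<^class>\<open>group_add\<close>: written additively, but not commutative.\<close>

lemma add_idem_iff: "x + x = x \<longleftrightarrow> x = (0::'k::group_add)"
  by (metis add.right_neutral add_left_cancel)

definition diff_by :: "'k::group_add \<Rightarrow> ('k \<Rightarrow> int) \<Rightarrow> 'k \<Rightarrow> int" where
  "diff_by g f x = f (g + x) - f x"

text \<open>Degree less than \<open>n\<close>: level 0 holds only the zero function, level 1 the
  constants.\<close>

fun poly_fun :: "nat \<Rightarrow> ('k::group_add \<Rightarrow> int) \<Rightarrow> bool" where
  "poly_fun 0 f \<longleftrightarrow> (\<forall>x. f x = 0)"
| "poly_fun (Suc n) f \<longleftrightarrow> (\<forall>g. poly_fun n (diff_by g f))"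

lemma poly_fun_zero: "poly_fun n (\<lambda>x. 0)"
  by (induction n) (auto simp: diff_by_def[abs_def])

lemma poly_fun_add: "poly_fun n f \<Longrightarrow> poly_fun n h \<Longrightarrow> poly_fun n (\<lambda>x. f x + h x)"
proof (induction n arbitrary: f h)
  case (Suc n)
  have "diff_by g (\<lambda>x. f x + h x) = (\<lambda>x. diff_by g f x + diff_by g h x)" for g
    by (auto simp: diff_by_def)
  then show ?case using Suc by simp
qed simp

lemma diff_by_scale: "diff_by g (\<lambda>x. c * f x) = (\<lambda>x. c * diff_by g f x)"
  by (auto simp: diff_by_def algebra_simps)

lemma poly_fun_scale: "poly_fun n f \<Longrightarrow> poly_fun n (\<lambda>x. c * f x)"
  by (induction n arbitrary: f) (auto simp: diff_by_scale)

lemma poly_fun_scaleD: "poly_fun n (\<lambda>x. c * f x) \<Longrightarrow> c \<noteq> 0 \<Longrightarrow> poly_fun n f"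
  by (induction n arbitrary: f) (auto simp: diff_by_scale)

lemma poly_fun_uminus: "poly_fun n f \<Longrightarrow> poly_fun n (\<lambda>x. - f x)"
  using poly_fun_scale[of n f "-1"] by simp

lemma poly_fun_diff: "poly_fun n f \<Longrightarrow> poly_fun n h \<Longrightarrow> poly_fun n (\<lambda>x. f x - h x)"
  using poly_fun_add[OF _ poly_fun_uminus, of n f h] by simp

lemma poly_fun_hom:
  assumes hom: "\<And>x y. h (x + y) = h x + h y"
  shows "poly_fun n f \<Longrightarrow> poly_fun n (\<lambda>x. f (h x))"
proof (induction n arbitrary: f)
  case (Suc n)
  have "diff_by g (\<lambda>x. f (h x)) = (\<lambda>x. diff_by (h g) f (h x))" for g
    by (auto simp: diff_by_def hom)
  then show ?case using Suc by simp
qed simp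

text \<open>The difference by \<open>h\<close> of a translate is a translate of the difference by
  the conjugate \<open>g + h - g\<close>.\<close>

lemma poly_fun_translate: "poly_fun n f \<Longrightarrow> poly_fun n (\<lambda>x. f (g + x))"
proof (induction n arbitrary: f)
  case (Suc n)
  have "diff_by h (\<lambda>x. f (g + x)) = (\<lambda>x. diff_by (g + h - g) f (g + x))" for h
    by (auto simp: diff_by_def add.assoc[symmetric])
  then show ?case using Suc by simp
qed simp

lemma poly_fun_Suc: "poly_fun n f \<Longrightarrow> poly_fun (Suc n) f"
proof (induction n arbitrary: f)
  case 0
  then show ?case by (simp add: diff_by_def)
next
  case (Suc n)
  then show ?case by (metis poly_fun.simps(2))
qed

lemma poly_fun_mono: "poly_fun m f \<Longrightarrow> m \<le> n \<Longrightarrow> poly_fun n f"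
  by (induction n) (auto simp: le_Suc_eq simp del: poly_fun.simps intro: poly_fun_Suc)

text \<open>A cocycle identity; with it, degree can be tested on generators.\<close>

lemma poly_fun_diff_by_add:
  assumes "poly_fun n (diff_by g f)" "poly_fun n (diff_by h f)"
  shows "poly_fun n (diff_by (g + h) f)"
proof -
  have "diff_by (g + h) f = (\<lambda>x. diff_by g f (h + x) + diff_by h f x)"
    by (auto simp: diff_by_def add.assoc)
  then show ?thesis using poly_fun_add[OF poly_fun_translate assms(2)] assms by simp
qed

lemma poly_fun_diff_by_uminus:
  assumes "poly_fun n (diff_by g f)"
  shows "poly_fun n (diff_by (- g) f)"
proof -
  have "diff_by (- g) f = (\<lambda>x. - diff_by g f (- g + x))"
    by (auto simp: diff_by_def add.assoc[symmetric])
  then show ?thesis using poly_fun_uminus[OF poly_fun_translate[OF assms, of "-g"]] by simp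
qed

lemma poly_fun_diff_by_0: "poly_fun n (diff_by 0 f)"
  by (simp add: diff_by_def[abs_def] poly_fun_zero)

section \<open>The filtration dual to polynomial degree\<close>

text \<open>A dimension series defined through functions. Quantifying over every \<open>k\<close>
  lets differences by elements of levels \<open>n\<close> and \<open>m\<close> be composed, so that
  levels add.\<close>

definition poly_filt :: "nat \<Rightarrow> 'k::group_add set" where
  "poly_filt n = {g. \<forall>k f. poly_fun (k + n) f \<longrightarrow> poly_fun k (diff_by g f)}"

lemma poly_filtD: "g \<in> poly_filt n \<Longrightarrow> poly_fun (k + n) f \<Longrightarrow> poly_fun k (diff_by g f)"
  by (auto simp: poly_filt_def)

lemma poly_filt_1: "g \<in> poly_filt (Suc 0)"
  by (auto simp: poly_filt_def)

lemma poly_filt_0: "g \<in> poly_filt 0"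
  using poly_fun_Suc by (force simp: poly_filt_def)

lemma poly_filt_zero: "0 \<in> poly_filt n"
  by (auto simp: poly_filt_def poly_fun_diff_by_0)

lemma poly_filt_add: "g \<in> poly_filt n \<Longrightarrow> h \<in> poly_filt n \<Longrightarrow> g + h \<in> poly_filt n"
  by (auto simp: poly_filt_def poly_fun_diff_by_add)

lemma poly_filt_uminus: "g \<in> poly_filt n \<Longrightarrow> - g \<in> poly_filt n"
  by (auto simp: poly_filt_def poly_fun_diff_by_uminus)

text \<open>As in the group ring, \<open>g h - h g = ([g, h] - 1) h g\<close>: the difference by the
  commutator is a translate of the commutator of the two difference operators.\<close>

lemma poly_filt_commutator:
  fixes g h :: "'k::group_add"
  assumes g: "g \<in> poly_filt n" and h: "h \<in> poly_filt m"
  shows "g + h - g - h \<in> poly_filt (n + m)"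
  unfolding poly_filt_def
proof safe
  fix k and f :: "'k \<Rightarrow> int" assume f: "poly_fun (k + (n + m)) f"
  have "poly_fun (k + m) (diff_by g f)"
    by (rule poly_filtD[OF g]) (use f in \<open>simp add: ac_simps\<close>)
  then have 1: "poly_fun k (diff_by h (diff_by g f))" by (rule poly_filtD[OF h])
  have "poly_fun (k + n) (diff_by h f)"
    by (rule poly_filtD[OF h]) (use f in \<open>simp add: ac_simps\<close>)
  then have 2: "poly_fun k (diff_by g (diff_by h f))" by (rule poly_filtD[OF g])
  define e where "e = (\<lambda>x. diff_by h (diff_by g f) x - diff_by g (diff_by h f) x)"
  have "poly_fun k e" unfolding e_def by (rule poly_fun_diff[OF 1 2])
  then have "poly_fun k (\<lambda>x. e (- (h + g) + x))" by (rule poly_fun_translate)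
  moreover have "diff_by (g + h - g - h) f = (\<lambda>x. e (- (h + g) + x))"
  proof
    fix x
    have "g + h - g - h + x = g + (h + (- (h + g) + x))"
      by (simp only: minus_add diff_conv_add_uminus add.assoc)
    moreover have "x = h + (g + (- (h + g) + x))"
      by (simp only: minus_add add.assoc add_minus_cancel minus_add_cancel)
    ultimately show "diff_by (g + h - g - h) f x = e (- (h + g) + x)"
      by (simp add: diff_by_def e_def)
  qed
  ultimately show "poly_fun k (diff_by (g + h - g - h) f)" by simp
qed

fun nat_mult :: "nat \<Rightarrow> 'k::group_add \<Rightarrow> 'k" where
  "nat_mult 0 g = 0"
| "nat_mult (Suc n) g = g + nat_mult n g"

text \<open>Modulo \<open>poly_fun k\<close>, the difference by \<open>nat_mult j g\<close> is
  \<open>j\<close> times the difference by \<open>g\<close>, and a nonzero integer factor can be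
  divided out.\<close>

lemma poly_filt_isolated:
  fixes g :: "'k::group_add"
  assumes g: "g \<in> poly_filt n" and n: "n > 0" and j: "j > 0"
    and gj: "nat_mult j g \<in> poly_filt (Suc n)"
  shows "g \<in> poly_filt (Suc n)"
  unfolding poly_filt_def
proof safe
  fix k and f :: "'k \<Rightarrow> int" assume f: "poly_fun (k + Suc n) f"
  have d: "poly_fun (Suc k) (diff_by g f)"
    by (rule poly_filtD[OF g]) (use f in simp)
  have "poly_fun k (\<lambda>x. diff_by (nat_mult j g) f x - int j * diff_by g f x)" for j
  proof (induction j)
    case 0
    then show ?case by (simp add: poly_fun_zero diff_by_def)
  next
    case (Suc j)
    have "poly_fun k (diff_by (nat_mult j g) (diff_by g f))" using d by auto
    from poly_fun_add[OF Suc this]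
    show ?case by (simp add: diff_by_def algebra_simps)
  qed
  moreover have "poly_fun k (diff_by (nat_mult j g) f)" using poly_filtD[OF gj f] .
  ultimately have "poly_fun k (\<lambda>x. diff_by (nat_mult j g) f x
      - (diff_by (nat_mult j g) f x - int j * diff_by g f x))"
    by (rule poly_fun_diff[rotated])
  then have "poly_fun k (\<lambda>x. int j * diff_by g f x)" by simp
  then show "poly_fun k (diff_by g f)" using j by (auto dest: poly_fun_scaleD)
qed

lemma poly_filt_torsion_free:
  fixes g :: "'k::group_add"
  assumes j: "j > 0" and gj: "nat_mult j g \<in> poly_filt (Suc n)"
  shows "g \<in> poly_filt (Suc n)"
proof -
  have anti: "poly_filt (Suc m) \<subseteq> poly_filt m" for m
    using poly_fun_Suc by (force simp: poly_filt_def)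
  have "g \<in> poly_filt (Suc m)" if "m \<le> n" for m
    using that
  proof (induction m)
    case 0
    show ?case by (rule poly_filt_1)
  next
    case (Suc m)
    have "nat_mult j g \<in> poly_filt (Suc (Suc m))"
      using gj lift_Suc_antimono_le[of "poly_filt", OF anti, of "Suc (Suc m)" "Suc n"] Suc.prems
      by auto
    then show ?case using poly_filt_isolated[of g "Suc m" j] Suc j by auto
  qed
  then show ?thesis by simp
qed

lemma poly_filt_separates:
  assumes "poly_fun n f" "f g \<noteq> f 0"
  shows "g \<notin> poly_filt n"
proof
  assume "g \<in> poly_filt n"
  then have "poly_fun 0 (diff_by g f)" using assms(1) poly_filtD[of g n 0 f] by simp
  then show False using assms(2) by (auto simp: diff_by_def dest: spec[of _ 0])
qed

section \<open>A criterion for residual torsion-free nilpotence\<close>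

context group
begin

lemma nat_mult_hom:
  fixes \<rho> :: "'a \<Rightarrow> 'k::group_add"
  assumes hom: "\<And>x y. x \<in> carrier G \<Longrightarrow> y \<in> carrier G \<Longrightarrow> \<rho> (x \<otimes> y) = \<rho> x + \<rho> y"
    and x: "x \<in> carrier G"
  shows "\<rho> (x [^] n) = nat_mult n (\<rho> x)"
proof (induction n)
  case 0
  have "\<rho> \<one> + \<rho> \<one> = \<rho> \<one>" using hom[of \<one> \<one>] by simp
  then have "\<rho> \<one> = 0" by (simp only: add_idem_iff)
  then show ?case by simp
next
  case (Suc n)
  have "\<rho> (x [^] Suc n) = \<rho> (x \<otimes> x [^] n)" using x by (simp only: nat_pow_Suc2)
  then show ?case using Suc x hom by simp
qed

end

context normal
begin

lemma Mod_hom: "group_hom G (G Mod H) (\<lambda>x. H #> x)"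
  using r_coset_hom_Mod factorgroup_is_group is_group
  by (simp add: group_hom_def group_hom_axioms_def)

lemma carrier_ModE:
  assumes "A \<in> carrier (G Mod H)"
  obtains x where "x \<in> carrier G" "A = H #> x"
  using assms by (auto simp: FactGroup_def RCOSETS_def)

lemma r_coset_eq_one_iff: "x \<in> carrier G \<Longrightarrow> H #> x = \<one>\<^bsub>G Mod H\<^esub> \<longleftrightarrow> x \<in> H"
  using coset_join1[OF _ _ subgroup_axioms] rcos_const[OF is_group] by (auto simp: FactGroup_def)

lemma torsion_free_Mod:
  assumes "\<And>x j. x \<in> carrier G \<Longrightarrow> j > 0 \<Longrightarrow> x [^] (j::nat) \<in> H \<Longrightarrow> x \<in> H"
  shows "torsion_free (G Mod H)"
  unfolding torsion_free_def
proof (intro ballI allI impI)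
  fix A and j :: nat
  assume A: "A \<in> carrier (G Mod H)" and j: "j > 0" and Aj: "A [^]\<^bsub>G Mod H\<^esub> j = \<one>\<^bsub>G Mod H\<^esub>"
  obtain x where x: "x \<in> carrier G" "A = H #> x" using A by (rule carrier_ModE)
  interpret h: group_hom G "G Mod H" "\<lambda>x. H #> x" by (rule Mod_hom)
  have "H #> (x [^] j) = \<one>\<^bsub>G Mod H\<^esub>" using h.hom_nat_pow[OF x(1), of j] Aj x(2) by metis
  then have "x [^] j \<in> H" using r_coset_eq_one_iff[of "x [^] j"] nat_pow_closed[OF x(1)] by blast
  then have "x \<in> H" by (rule assms[OF x(1) j])
  then show "A = \<one>\<^bsub>G Mod H\<^esub>" using r_coset_eq_one_iff[OF x(1)] x(2) by blast
qed

lemma nilpotent_group_Mod: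
  assumes sub: "\<And>i. subgroup (D i) G"
    and D0: "D 0 = carrier G" and Dn: "D n = H"
    and comm: "\<And>i x y. x \<in> D i \<Longrightarrow> y \<in> carrier G \<Longrightarrow> commutator G x y \<in> D (Suc i)"
  shows "nilpotent_group (G Mod H)"
proof -
  interpret h: group_hom G "G Mod H" "\<lambda>x. H #> x" by (rule Mod_hom)
  have "lower_central (G Mod H) i \<subseteq> (\<lambda>x. H #> x) ` D i" for i
  proof (induction i)
    case 0
    show ?case by (auto simp: FactGroup_def RCOSETS_def D0)
  next
    case (Suc i)
    have "{commutator (G Mod H) A B | A B. A \<in> lower_central (G Mod H) i \<and> B \<in> carrier (G Mod H)}
        \<subseteq> (\<lambda>x. H #> x) ` D (Suc i)"
    proof safe
      fix A B assume A: "A \<in> lower_central (G Mod H) i" and B: "B \<in> carrier (G Mod H)"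
      obtain x where x: "x \<in> D i" "A = H #> x" using A Suc by blast
      obtain y where y: "y \<in> carrier G" "B = H #> y" using B by (rule carrier_ModE)
      have xc: "x \<in> carrier G" using subgroup.mem_carrier[OF sub x(1)] .
      have "commutator (G Mod H) A B = H #> commutator G x y"
        unfolding commutator_def x(2) y(2)
        by (simp only: h.hom_mult h.hom_inv xc y(1) m_closed inv_closed)
      then show "commutator (G Mod H) A B \<in> (\<lambda>x. H #> x) ` D (Suc i)"
        using comm[OF x(1) y(1)] by (rule image_eqI)
    qed
    then show ?case
      unfolding lower_central.simps
      by (rule h.H.generate_subgroup_incl) (rule h.subgroup_img_is_subgroup[OF sub])
  qed
  from this[of n] have "lower_central (G Mod H) n \<subseteq> {\<one>\<^bsub>G Mod H\<^esub>}"
    using r_coset_eq_one_iff[OF mem_carrier] unfolding Dn by (simp add: image_subset_iff subset_iff) blast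
  moreover have "\<one>\<^bsub>G Mod H\<^esub> \<in> lower_central (G Mod H) n"
  proof (cases n)
    case 0
    show ?thesis unfolding 0 lower_central.simps by (rule h.H.one_closed)
  next
    case (Suc m)
    show ?thesis unfolding Suc lower_central.simps by (rule generate.one)
  qed
  ultimately have "lower_central (G Mod H) n = {\<one>\<^bsub>G Mod H\<^esub>}" by blast
  then show ?thesis
    unfolding nilpotent_group_def by (intro conjI exI[of _ n] factorgroup_is_group)
qed

end

context group
begin

theorem residually_tf_nilpotent_by_poly_fun:
  fixes \<rho> :: "'a \<Rightarrow> 'k::group_add"
  assumes hom: "\<And>x y. x \<in> carrier G \<Longrightarrow> y \<in> carrier G \<Longrightarrow> \<rho> (x \<otimes> y) = \<rho> x + \<rho> y"
    and inj: "inj_on \<rho> (carrier G)"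
    and sep: "\<And>g::'k. g \<noteq> 0 \<Longrightarrow> \<exists>n f. poly_fun n f \<and> f g \<noteq> f 0"
  shows "residually_tf_nilpotent G"
  unfolding residually_tf_nilpotent_def
proof safe
  fix g assume g: "g \<in> carrier G" "g \<noteq> \<one>"
  have "\<rho> \<one> + \<rho> \<one> = \<rho> \<one>" using hom[of \<one> \<one>] by simp
  then have one: "\<rho> \<one> = 0" by (simp only: add_idem_iff)
  have inv: "\<rho> (inv x) = - \<rho> x" if "x \<in> carrier G" for x
    using hom[of x "inv x"] that one by (simp add: eq_neg_iff_add_eq_0 minus_unique)
  define D where "D n = {x \<in> carrier G. \<rho> x \<in> poly_filt n}" for n
  have nrm: "D n \<lhd> G" for n
  proof (rule normal_invI)
    show "subgroup (D n) G"
      by unfold_locales (auto simp: D_def hom one inv poly_filt_add poly_filt_zero poly_filt_uminus)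
  next
    fix x h assume x: "x \<in> carrier G" and h: "h \<in> D n"
    \<comment> \<open>Level 0 is the whole group, so the commutator of \<open>h\<close> with an
      arbitrary \<open>x\<close> stays in level \<open>n\<close>.\<close>
    have "\<rho> x + \<rho> h - \<rho> x - \<rho> h \<in> poly_filt (0 + n)"
      using h by (intro poly_filt_commutator poly_filt_0) (auto simp: D_def)
    then have "\<rho> x + \<rho> h - \<rho> x - \<rho> h + \<rho> h \<in> poly_filt n"
      using h by (intro poly_filt_add) (auto simp: D_def)
    then show "x \<otimes> h \<otimes> inv x \<in> D n"
      using x h by (auto simp: D_def hom inv)
  qed
  have "\<rho> g \<noteq> 0" using g one inj by (metis inj_onD one_closed)
  from sep[OF this] obtain n f where nf: "poly_fun n f" "f (\<rho> g) \<noteq> f 0" by (elim exE conjE)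
  have "\<rho> g \<notin> poly_filt (Suc n)"
    by (rule poly_filt_separates) (rule poly_fun_Suc, rule nf(1), rule nf(2))
  then have "g \<notin> D (Suc n)" unfolding D_def by blast
  moreover have "torsion_free (G Mod D (Suc n))"
  proof (rule normal.torsion_free_Mod[OF nrm])
    fix x and j :: nat
    assume x: "x \<in> carrier G" and j: "j > 0" and "x [^] j \<in> D (Suc n)"
    then have "nat_mult j (\<rho> x) \<in> poly_filt (Suc n)"
      using nat_mult_hom[of \<rho> x j, OF hom] by (simp add: D_def)
    then show "x \<in> D (Suc n)" using poly_filt_torsion_free[OF j] x by (auto simp: D_def)
  qed
  moreover have "nilpotent_group (G Mod D (Suc n))"
  \<comment> \<open>Level 1 is already all of \<open>G\<close>, so the central series starts there
    and reaches \<open>D (Suc n)\<close> after \<open>n\<close> steps.\<close>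
  proof (rule normal.nilpotent_group_Mod[OF nrm, where D = "\<lambda>i. D (Suc i)" and n = n])
    show "subgroup (D (Suc i)) G" for i using nrm by (rule normal_imp_subgroup)
    show "D (Suc 0) = carrier G" by (simp add: D_def poly_filt_1)
  next
    fix i x y assume x: "x \<in> D (Suc i)" and y: "y \<in> carrier G"
    have xc: "x \<in> carrier G" using x by (simp add: D_def)
    have "\<rho> x + \<rho> y - \<rho> x - \<rho> y \<in> poly_filt (Suc i + Suc 0)"
      using x by (intro poly_filt_commutator poly_filt_1) (auto simp: D_def)
    then show "commutator G x y \<in> D (Suc (Suc i))"
      using xc y by (simp add: commutator_def D_def hom inv)
  qed simp
  ultimately show "\<exists>N. N \<lhd> G \<and> g \<notin> N \<and> nilpotent_group (G Mod N) \<and> torsion_free (G Mod N)"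
    by (intro exI[of _ "D (Suc n)"] conjI nrm)
qed

end

section \<open>Magnus functionals\<close>

type_synonym ('s, 'j) functional = "('s \<Rightarrow> int) \<Rightarrow> ('j \<times> ('s \<Rightarrow> int)) list \<Rightarrow> int"

definition precomp :: "('s \<Rightarrow> 's) \<Rightarrow> ('s, 'j) functional \<Rightarrow> ('s, 'j) functional" where
  "precomp g \<phi> f q = \<phi> (\<lambda>s. f (g s)) q"

text \<open>Left multiplication by \<open>1 + t\<close>, indexed by \<open>j\<close>: the new
  \<open>t\<close> leaves the identity in front, hence \<open>f b\<close>, and \<open>h\<close>
  takes the leading slot.\<close>

fun magnus :: "'s \<Rightarrow> 'j \<Rightarrow> ('s, 'j) functional \<Rightarrow> ('s, 'j) functional" where
  "magnus b j \<phi> f [] = \<phi> f []"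
| "magnus b j \<phi> f ((i, h) # q) = \<phi> f ((i, h) # q) + (if i = j then f b * \<phi> h q else 0)"

text \<open>Solves \<open>psi + t psi = phi\<close> for \<open>psi\<close>; the recursion ends
  because \<open>t psi\<close> is evaluated on a shorter list.\<close>

fun magnus_inv :: "'s \<Rightarrow> 'j \<Rightarrow> ('s, 'j) functional \<Rightarrow> ('s, 'j) functional" where
  "magnus_inv b j \<phi> f [] = \<phi> f []"
| "magnus_inv b j \<phi> f ((i, h) # q) =
     \<phi> f ((i, h) # q) - (if i = j then f b * magnus_inv b j \<phi> h q else 0)"

definition unit_functional :: "'s \<Rightarrow> ('s, 'j) functional" where
  "unit_functional b f q = (if q = [] then f b else 0)"

lemma magnus_magnus_inv [simp]: "magnus b j (magnus_inv b j \<phi>) = \<phi>"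
proof (intro ext)
  fix f q show "magnus b j (magnus_inv b j \<phi>) f q = \<phi> f q"
    by (cases q) (auto split: prod.splits)
qed

lemma magnus_inv_magnus [simp]: "magnus_inv b j (magnus b j \<phi>) = \<phi>"
proof (intro ext)
  fix f q show "magnus_inv b j (magnus b j \<phi>) f q = \<phi> f q"
    by (induction q arbitrary: f) auto
qed

lemma precomp_precomp: "precomp g (precomp h \<phi>) = precomp (g \<circ> h) \<phi>"
  by (auto simp: precomp_def fun_eq_iff)

lemma precomp_id [simp]: "precomp (\<lambda>s. s) \<phi> = \<phi>"
  by (auto simp: precomp_def fun_eq_iff)

section \<open>Integer multiples in an additively written group\<close>

definition int_mult :: "int \<Rightarrow> 'k::group_add \<Rightarrow> 'k" where
  "int_mult n x = (if n \<ge> 0 then nat_mult (nat n) x else nat_mult (nat (- n)) (- x))"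

lemma int_mult_0 [simp]: "int_mult 0 x = 0"
  by (simp add: int_mult_def)

lemma int_mult_plus1: "int_mult (n + 1) x = x + int_mult n x"
proof (cases "n \<ge> 0")
  case True
  then show ?thesis by (simp add: int_mult_def nat_add_distrib)
next
  case False
  then have "nat (- n) = Suc (nat (- n - 1))" by simp
  with False show ?thesis
    by (auto simp: int_mult_def add.assoc[symmetric] minus_diff_commute)
qed

lemma int_mult_minus1: "int_mult (n - 1) x = - x + int_mult n x"
  using int_mult_plus1[of "n - 1" x] by (simp add: add.assoc[symmetric])

section \<open>Polynomial functions on a free product with a free group\<close>

text \<open>
  The group is generated by the free letters \<open>Z j\<close> and the image of a factor that is only
  seen through its regular action: the letters \<open>Y y\<close> move the points of a set with base
  point \<open>b\<close>, and \<open>\<theta>\<close> inverts the orbit map. \<open>F w f [(j1, f1), \<dots>, (jk, fk)]\<close> is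
  the value of \<open>f \<otimes> f1 \<otimes> \<dots> \<otimes> fk\<close> on the component of \<open>w\<close> along
  \<open>g0 t g1 t \<dots> t gk\<close>, after substituting \<open>1 + t\<close> (indexed by \<open>j\<close>) for each \<open>Z j\<close>.
\<close>

locale magnus_group =
  fixes Z :: "'j \<Rightarrow> 'k::group_add" and Y :: "'y \<Rightarrow> 'k" and act :: "'y \<Rightarrow> 's \<Rightarrow> 's" and b :: 's
    and \<theta> :: "'s \<Rightarrow> 'k" and F :: "'k \<Rightarrow> ('s, 'j) functional"
  assumes \<theta>_base: "\<theta> b = 0"
    and \<theta>_act: "\<And>y s. \<theta> (act y s) = Y y + \<theta> s"
    and F_0: "F 0 = unit_functional b"
    and F_Y: "\<And>y w. F (Y y + w) = precomp (act y) (F w)"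
    and F_X: "\<And>j w. F (Z j + w) = magnus b j (F w)"
    and generated: "\<And>P w. P 0 \<Longrightarrow> (\<And>y w. P w \<Longrightarrow> P (Y y + w)) \<Longrightarrow> (\<And>j w. P w \<Longrightarrow> P (Z j + w)) \<Longrightarrow>
        (\<And>j w. P w \<Longrightarrow> P (- Z j + w)) \<Longrightarrow> P w"
begin

lemma F_mX: "F (- Z j + w) = magnus_inv b j (F w)"
  using F_X[of j "- Z j + w"] by (metis add_minus_cancel magnus_inv_magnus)

text \<open>The points carry no group structure, so degree is measured along the letters
  \<open>Y y\<close>.\<close>

fun poly_on :: "nat \<Rightarrow> ('s \<Rightarrow> int) \<Rightarrow> bool" where
  "poly_on 0 f \<longleftrightarrow> (\<forall>s. f s = 0)"
| "poly_on (Suc n) f \<longleftrightarrow> (\<forall>y. poly_on n (\<lambda>s. f (act y s) - f s))"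

lemma poly_on_Suc: "poly_on n f \<Longrightarrow> poly_on (Suc n) f"
proof (induction n arbitrary: f)
  case (Suc n)
  then show ?case by (metis poly_on.simps(2))
qed simp

lemma poly_on_mono: "poly_on m f \<Longrightarrow> m \<le> n \<Longrightarrow> poly_on n f"
  by (induction n) (auto simp: le_Suc_eq simp del: poly_on.simps intro: poly_on_Suc)

lemma poly_on_const: "poly_on 1 (\<lambda>s. c)"
  by simp

text \<open>Linearity in the leading slot turns a difference of \<open>F w f q\<close> along
  \<open>Y y\<close> into a difference of \<open>f\<close>.\<close>

lemma F_diff: "F w (\<lambda>s. f s - h s) q = F w f q - F w h q"
proof (induction w arbitrary: f h q rule: generated)
  case 1
  then show ?case by (simp add: F_0 unit_functional_def)
next
  case (2 y w)
  then show ?case by (simp add: F_Y precomp_def)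
next
  case (3 j w)
  then show ?case by (cases q) (auto simp: F_X algebra_simps split: prod.splits)
next
  case (4 j w)
  then show ?case by (cases q) (auto simp: F_mX algebra_simps split: prod.splits)
qed

lemma poly_fun_SucI:
  assumes Y: "\<And>y. poly_fun n (diff_by (Y y) f)" and Z: "\<And>j. poly_fun n (diff_by (Z j) f)"
  shows "poly_fun (Suc n) f"
proof -
  have "poly_fun n (diff_by g f)" for g
    by (induction g rule: generated)
       (auto intro: poly_fun_diff_by_add poly_fun_diff_by_0 poly_fun_diff_by_uminus Y Z)
  then show ?thesis by simp
qed

text \<open>A difference along \<open>Y y\<close> lowers the degree of \<open>f\<close>; one along
  \<open>Z j\<close> strips the head of \<open>q\<close> and makes its function the leading
  one.\<close>

lemma poly_fun_F:
  assumes "poly_on n f" "\<forall>(i, h)\<in>set q. poly_on d h"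
  shows "poly_fun (n + d * length q) (\<lambda>w. F w f q)"
  using assms(2,1)
proof (induction q arbitrary: n f)
  case Nil
  then show ?case
  proof (induction n arbitrary: f)
    case 0
    then show ?case using F_diff[of _ f f "[]"] by simp
  next
    case (Suc n)
    have "diff_by (Y y) (\<lambda>w. F w f []) = (\<lambda>w. F w (\<lambda>s. f (act y s) - f s) [])" for y
      by (auto simp: diff_by_def F_Y precomp_def F_diff)
    moreover have "diff_by (Z j) (\<lambda>w. F w f []) = (\<lambda>w. 0)" for j
      by (auto simp: diff_by_def F_X)
    ultimately show ?case
      using Suc by (auto intro!: poly_fun_SucI poly_fun_zero simp del: poly_fun.simps)
  qed
next
  case (Cons ih q)
  obtain i h where ih: "ih = (i, h)" by (cases ih)
  have h: "poly_on d h" "\<forall>(i, h)\<in>set q. poly_on d h" using Cons.prems ih by auto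
  show ?case using Cons.prems(2)
  proof (induction n arbitrary: f)
    case 0
    then show ?case using F_diff[of _ f f "ih # q"] by (simp add: poly_fun_zero)
  next
    case (Suc n)
    have "diff_by (Y y) (\<lambda>w. F w f (ih # q)) = (\<lambda>w. F w (\<lambda>s. f (act y s) - f s) (ih # q))" for y
      by (auto simp: diff_by_def F_Y precomp_def F_diff)
    moreover have "diff_by (Z j) (\<lambda>w. F w f (ih # q)) = (\<lambda>w. (if i = j then f b else 0) * F w h q)" for j
      by (auto simp: diff_by_def F_X ih)
    moreover have "poly_fun (n + d * length (ih # q)) (\<lambda>w. F w h q)"
      by (rule poly_fun_mono[OF Cons.IH[OF h(2,1)]]) simp
    ultimately show ?case
      using Suc by (auto intro!: poly_fun_SucI poly_fun_scale poly_fun_zero simp del: poly_fun.simps)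
  qed
qed

subsection \<open>Syllables\<close>

definition Yw :: "'y list \<Rightarrow> 'k \<Rightarrow> 'k" where
  "Yw v w = foldr (\<lambda>y w. Y y + w) v w"

lemma Yw_simps [simp]: "Yw [] w = w" "Yw (y # v) w = Y y + Yw v w"
  by (auto simp: Yw_def)

abbreviation actw :: "'y list \<Rightarrow> 's \<Rightarrow> 's" where
  "actw v \<equiv> foldr act v"

text \<open>A word in the \<open>Y\<close> letters is determined by where it sends \<open>b\<close>;
  a word fixing \<open>b\<close> represents the identity.\<close>

lemma Yw_eq: "Yw v w = \<theta> (actw v b) + w"
  by (induction v) (auto simp: \<theta>_base \<theta>_act add.assoc)

lemma F_Yw: "F (Yw v w) f q = F w (\<lambda>s. f (actw v s)) q"
  by (induction v arbitrary: f) (auto simp: F_Y precomp_def)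

fun syl :: "('j \<times> int \<times> 'y list) list \<Rightarrow> 'k" where
  "syl [] = 0"
| "syl ((j, n, v) # r) = int_mult n (Z j) + Yw v (syl r)"

text \<open>Normal form in a free product: only neighbouring powers of the same free letter must be
  kept apart by a nontrivial element of the factor.\<close>

fun reduced :: "('j \<times> int \<times> 'y list) list \<Rightarrow> bool" where
  "reduced [] = True"
| "reduced ((j, n, v) # r) =
     (n \<noteq> 0 \<and> (r \<noteq> [] \<and> fst (hd r) = j \<longrightarrow> actw v b \<noteq> b) \<and> reduced r)"

lemma reduced_step:
  assumes r: "reduced r" and e: "e = 1 \<or> e = -1"
  shows "\<exists>v' r'. reduced r' \<and> int_mult e (Z j) + Yw v (syl r) = Yw v' (syl r')"
proof (cases "r \<noteq> [] \<and> fst (hd r) = j \<and> actw v b = b")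
  case False
  then have "reduced ((j, e, v) # r)" using r e by auto
  moreover have "int_mult e (Z j) + Yw v (syl r) = Yw [] (syl ((j, e, v) # r))" by simp
  ultimately show ?thesis by metis
next
  case True
  then obtain n u r1 where r1: "r = (j, n, u) # r1" by (cases r) auto
  have v: "Yw v w = w" for w using True by (simp add: Yw_eq \<theta>_base)
  have mult: "int_mult e (Z j) + (int_mult n (Z j) + w) = int_mult (n + e) (Z j) + w" for w
    using e int_mult_plus1[of 0 "Z j"] int_mult_minus1[of 0 "Z j"] int_mult_plus1[of n "Z j"]
      int_mult_minus1[of n "Z j"] by (auto simp: add.assoc[symmetric])
  have eq: "int_mult e (Z j) + Yw v (syl r) = int_mult (n + e) (Z j) + Yw u (syl r1)"
    by (simp only: v r1 syl.simps mult)
  show ?thesis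
  proof (cases "n + e = 0")
    case True
    then show ?thesis using eq r r1 by auto
  next
    case False
    then have "reduced ((j, n + e, u) # r1)" using r r1 by auto
    moreover have "int_mult e (Z j) + Yw v (syl r) = Yw [] (syl ((j, n + e, u) # r1))"
      using eq by simp
    ultimately show ?thesis by metis
  qed
qed

lemma ex_reduced: "\<exists>v r. reduced r \<and> w = Yw v (syl r)"
proof (induction w rule: generated)
  case 1
  then show ?case by (intro exI[of _ "[]"]) simp
next
  case (2 y w)
  then show ?case by (metis Yw_simps(2))
next
  case (3 j w)
  then show ?case using reduced_step[of _ 1 j] int_mult_plus1[of 0 "Z j"] by auto
next
  case (4 j w)
  then show ?case using reduced_step[of _ "-1" j] int_mult_minus1[of 0 "Z j"] by auto
qed

text \<open>Vanishing at \<open>b\<close> between equal indices hides the terms beyond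
  \<open>1 + n t\<close> in \<open>(1 + t)^n\<close>, so the exponent of a power of
  \<open>Z j\<close> can be read off.\<close>

fun admissible :: "('j \<times> ('s \<Rightarrow> int)) list \<Rightarrow> bool" where
  "admissible [] = True"
| "admissible ((i, h) # q) = ((q \<noteq> [] \<and> fst (hd q) = i \<longrightarrow> h b = 0) \<and> admissible q)"

lemma F_int_mult_skip:
  assumes "q = [] \<or> fst (hd q) \<noteq> j \<or> f b = 0"
  shows "F (int_mult n (Z j) + w) f q = F w f q"
proof (induction n rule: int_induct[where k = 0])
  case base
  show ?case by simp
next
  case (step1 n)
  then show ?case using assms by (cases q) (auto simp: int_mult_plus1 add.assoc F_X)
next
  case (step2 n)
  then show ?case using assms by (cases q) (auto simp: int_mult_minus1 add.assoc F_mX)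
qed

lemma F_int_mult:
  assumes q: "admissible ((j, h) # q)"
  shows "F (int_mult n (Z j) + w) f ((j, h) # q) = F w f ((j, h) # q) + n * f b * F w h q"
proof -
  have skip: "F (int_mult n (Z j) + w) h q = F w h q" for n
    using q by (intro F_int_mult_skip) auto
  show ?thesis
  proof (induction n rule: int_induct[where k = 0])
    case base
    show ?case by simp
  next
    case (step1 n)
    have "F (int_mult (n + 1) (Z j) + w) = magnus b j (F (int_mult n (Z j) + w))"
      by (simp add: int_mult_plus1 add.assoc F_X)
    then show ?case using step1 skip[of n] by (simp add: distrib_right)
  next
    case (step2 n)
    have "magnus_inv b j (F (int_mult n (Z j) + w)) h q = F w h q"
      using skip[of "n - 1"] by (simp add: int_mult_minus1 add.assoc F_mX)
    then show ?case using step2 by (simp add: int_mult_minus1 add.assoc F_mX algebra_simps)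
  qed
qed

text \<open>Each syllable consumes at most one entry of an admissible list, and the functional of
  the identity vanishes on whatever is left over.\<close>

lemma F_syl_vanish:
  "admissible q \<Longrightarrow> length q > length r \<Longrightarrow> F (Yw v (syl r)) f q = 0"
proof (induction r arbitrary: v f q)
  case Nil
  then show ?case by (auto simp: F_Yw F_0 unit_functional_def)
next
  case (Cons s r)
  obtain j n u where s: "s = (j, n, u)" by (cases s)
  obtain i h q1 where q: "q = (i, h) # q1" using Cons.prems(2) by (cases q) auto
  show ?case
  proof (cases "i = j")
    case True
    have "F (Yw v (syl (s # r))) f q = F (Yw u (syl r)) (\<lambda>s. f (actw v s)) q
        + n * f (actw v b) * F (Yw u (syl r)) h q1"
      using F_int_mult Cons.prems(1) q s True by (simp add: F_Yw)
    then show ?thesis using Cons.IH Cons.prems q by simp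
  next
    case False
    then have "F (Yw v (syl (s # r))) f q = F (Yw u (syl r)) (\<lambda>s. f (actw v s)) q"
      using F_int_mult_skip q s by (simp add: F_Yw)
    then show ?thesis using Cons.IH Cons.prems by simp
  qed
qed

text \<open>One entry per syllable isolates the product of the terms \<open>n t\<close>;
  \<open>c\<close> collects the exponents and the values of the separating functions. Arbitrary
  \<open>v\<close> and \<open>f\<close> let the induction insert \<open>u\<close> and
  \<open>h\<close>.\<close>

lemma F_syl_nonzero:
  assumes sep: "\<And>s. s \<noteq> b \<Longrightarrow> \<exists>n f. poly_on n f \<and> f b = 0 \<and> f s \<noteq> 0"
  shows "reduced r \<Longrightarrow> \<exists>q c. admissible q \<and> map fst q = map fst r \<and> c \<noteq> 0 \<and>
    (\<forall>(i, h)\<in>set q. \<exists>n. poly_on n h) \<and> (\<forall>v f. F (Yw v (syl r)) f q = f (actw v b) * c)"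
proof (induction r)
  case Nil
  show ?case
    by (intro exI[of _ "[]"] exI[of _ 1]) (simp add: F_Yw F_0 unit_functional_def)
next
  case (Cons s r)
  obtain j n u where s: "s = (j, n, u)" by (cases s)
  obtain q c where q: "admissible q" "map fst q = map fst r" "c \<noteq> 0"
      "\<forall>(i, h)\<in>set q. \<exists>n. poly_on n h" "\<And>v f. F (Yw v (syl r)) f q = f (actw v b) * c"
    using Cons s by auto
  have len: "length q = length r" using q(2) by (metis length_map)
  \<comment> \<open>Between powers of the same letter, \<open>actw u b\<close> differs from
    \<open>b\<close> and \<open>sep\<close> applies; otherwise the constant 1 serves.\<close>
  have "\<exists>h. (\<exists>m. poly_on m h) \<and> h (actw u b) \<noteq> 0 \<and> (r \<noteq> [] \<and> fst (hd r) = j \<longrightarrow> h b = 0)"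
  proof (cases "r \<noteq> [] \<and> fst (hd r) = j")
    case True
    then have "actw u b \<noteq> b" using Cons.prems s by auto
    then show ?thesis using sep by metis
  next
    case False
    then show ?thesis by (intro exI[of _ "\<lambda>s. 1"] conjI exI[of _ 1] poly_on_const) auto
  qed
  then obtain h m where h: "poly_on m h" "h (actw u b) \<noteq> 0"
    "r \<noteq> [] \<and> fst (hd r) = j \<longrightarrow> h b = 0" by blast
  have hd: "q \<noteq> [] \<Longrightarrow> fst (hd q) = fst (hd r)" "q = [] \<longleftrightarrow> r = []"
    using q(2) len by (metis hd_map map_is_Nil_conv) (use len in auto)
  have adm: "admissible ((j, h) # q)" using q(1) h(3) hd by auto
  have "F (Yw v (syl (s # r))) f ((j, h) # q) = f (actw v b) * (n * h (actw u b) * c)" for v f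
  proof -
    have "F (Yw v (syl (s # r))) f ((j, h) # q)
        = F (Yw u (syl r)) (\<lambda>s. f (actw v s)) ((j, h) # q) + n * f (actw v b) * F (Yw u (syl r)) h q"
      using F_int_mult[OF adm] s by (simp add: F_Yw)
    \<comment> \<open>The list is longer than \<open>r\<close>, so the first summand
      vanishes.\<close>
    also have "\<dots> = n * f (actw v b) * (h (actw u b) * c)"
      using F_syl_vanish[OF adm, of r] len q(5) by simp
    finally show ?thesis by (simp add: mult_ac)
  qed
  moreover have "n * h (actw u b) * c \<noteq> 0" using q(3) h(2) Cons.prems s by simp
  ultimately show ?case
    using adm q(2,4) h(1) s by (intro exI[of _ "(j, h) # q"] exI[of _ "n * h (actw u b) * c"]) auto
qed

theorem poly_fun_separates:
  fixes w :: 'k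
  assumes sep: "\<And>s. s \<noteq> b \<Longrightarrow> \<exists>n f. poly_on n f \<and> f b = 0 \<and> f s \<noteq> 0"
    and w: "w \<noteq> 0"
  shows "\<exists>n f. poly_fun n f \<and> f w \<noteq> f 0"
proof -
  obtain v r where r: "reduced r" and wr: "w = Yw v (syl r)" using ex_reduced by blast
  show ?thesis
  proof (cases "r = []")
    case True
    then have "actw v b \<noteq> b" using w wr by (auto simp: Yw_eq \<theta>_base)
    then obtain n f where f: "poly_on n f" "f b = 0" "f (actw v b) \<noteq> 0" using sep by blast
    have "F w f [] \<noteq> F 0 f []" using f wr True by (simp add: F_Yw F_0 unit_functional_def)
    moreover have "poly_fun n (\<lambda>w. F w f [])" using poly_fun_F[of n f "[]" 0] f by simp
    ultimately show ?thesis by blast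
  next
    case False
    obtain q c where q: "admissible q" "map fst q = map fst r" "c \<noteq> 0"
      "\<forall>(i, h)\<in>set q. \<exists>n. poly_on n h" "\<And>v f. F (Yw v (syl r)) f q = f (actw v b) * c"
      using F_syl_nonzero[OF sep r] by blast
    have "q \<noteq> []" using q(2) False by auto
    \<comment> \<open>\<open>F 0\<close> vanishes on nonempty lists, while \<open>F w\<close> takes
      the value \<open>c\<close>.\<close>
    then have "F w (\<lambda>s. 1) q \<noteq> F 0 (\<lambda>s. 1) q" using q wr by (simp add: F_0 unit_functional_def)
    moreover obtain d where "\<forall>(i, h)\<in>set q. poly_on d h"
    proof -
      have "\<exists>d. \<forall>(i, h)\<in>set q. poly_on d h" using q(4)
      proof (induction q)
        case (Cons ih q)
        obtain d m where "\<forall>(i, h)\<in>set q. poly_on d h" "poly_on m (snd ih)" using Cons by auto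
        then show ?case
          by (intro exI[of _ "max d m"]) (auto intro: poly_on_mono)
      qed simp
      then show ?thesis using that by blast
    qed
    then have "poly_fun (1 + d * length q) (\<lambda>w. F w (\<lambda>s. 1) q)"
      by (intro poly_fun_F poly_on_const)
    ultimately show ?thesis by blast
  qed
qed

end

section \<open>Free groups\<close>

type_synonym 'a word = "('a \<times> bool) list"

inductive free_eq :: "'a word \<Rightarrow> 'a word \<Rightarrow> bool" where
  refl: "free_eq w w"
| sym: "free_eq u v \<Longrightarrow> free_eq v u"
| trans: "free_eq u v \<Longrightarrow> free_eq v w \<Longrightarrow> free_eq u w"
| cancel: "free_eq (u @ [(a, e), (a, \<not> e)] @ v) (u @ v)"

lemma equivp_free_eq: "equivp free_eq"
  by (intro equivpI reflpI sympI transpI) (blast intro: free_eq.intros)+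

lemma free_eq_context: "free_eq u v \<Longrightarrow> free_eq (p @ u @ q) (p @ v @ q)"
proof (induction rule: free_eq.induct)
  case (cancel u a e v)
  show ?case using free_eq.cancel[of "p @ u" a e "v @ q"] by simp
qed (auto intro: free_eq.intros)

lemma free_eq_append: "free_eq u u' \<Longrightarrow> free_eq v v' \<Longrightarrow> free_eq (u @ v) (u' @ v')"
  using free_eq_context[of u u' "[]" v] free_eq_context[of v v' u' "[]"] free_eq.trans by fastforce

definition inv_word :: "'a word \<Rightarrow> 'a word" where
  "inv_word w = rev (map (\<lambda>(a, e). (a, \<not> e)) w)"

lemma inv_word_simps [simp]:
  "inv_word [] = []" "inv_word ((a, e) # w) = inv_word w @ [(a, \<not> e)]"
  "inv_word (u @ v) = inv_word v @ inv_word u"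
  by (auto simp: inv_word_def)

lemma free_eq_inv_word: "free_eq u v \<Longrightarrow> free_eq (inv_word u) (inv_word v)"
proof (induction rule: free_eq.induct)
  case (cancel u a e v)
  show ?case using free_eq.cancel[of "inv_word v" a e "inv_word u"] by simp
qed (auto intro: free_eq.intros)

lemma free_eq_left_inverse: "free_eq (inv_word w @ w) []"
proof (induction w)
  case Nil
  show ?case by (simp add: free_eq.refl)
next
  case (Cons x w)
  obtain a e where x: "x = (a, e)" by (cases x)
  have "free_eq (inv_word w @ [(a, \<not> e), (a, \<not> \<not> e)] @ w) (inv_word w @ w)" by (rule free_eq.cancel)
  with Cons show ?case using x by (auto intro: free_eq.trans)
qed

quotient_type 'a free_group = "'a word" / free_eq
  by (rule equivp_free_eq)

instantiation free_group :: (type) group_add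
begin

lift_definition zero_free_group :: "'a free_group" is "[]" .
lift_definition plus_free_group :: "'a free_group \<Rightarrow> 'a free_group \<Rightarrow> 'a free_group" is "(@)"
  by (rule free_eq_append)
lift_definition uminus_free_group :: "'a free_group \<Rightarrow> 'a free_group" is inv_word
  by (rule free_eq_inv_word)
definition minus_free_group :: "'a free_group \<Rightarrow> 'a free_group \<Rightarrow> 'a free_group" where
  "minus_free_group u v = u + - v"

instance
proof
  fix u v w :: "'a free_group"
  show "u + v + w = u + (v + w)" by transfer (simp add: free_eq.refl)
  show "0 + u = u" by transfer (simp add: free_eq.refl)
  show "u + 0 = u" by transfer (simp add: free_eq.refl)
  show "- u + u = 0" by transfer (rule free_eq_left_inverse)
  show "u + - v = u - v" by (simp add: minus_free_group_def)
qed

end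

lift_definition gen :: "'a \<Rightarrow> 'a free_group" is "\<lambda>a. [(a, False)]" .

lemma abs_Cons: "abs_free_group ((a, e) # w) = (if e then - gen a else gen a) + abs_free_group w"
proof -
  have "abs_free_group ((a, e) # w) = abs_free_group [(a, e)] + abs_free_group w"
    by (simp add: plus_free_group.abs_eq)
  moreover have "abs_free_group [(a, e)] = (if e then - gen a else gen a)"
    by (auto simp: gen.abs_eq uminus_free_group.abs_eq)
  ultimately show ?thesis by simp
qed

lemma free_group_induct [case_names zero gen inv]:
  assumes "P 0" "\<And>a w. P w \<Longrightarrow> P (gen a + w)" "\<And>a w. P w \<Longrightarrow> P (- gen a + w)"
  shows "P w"
proof (induction w rule: free_group.abs_induct)
  case (1 w)
  show ?case
  proof (induction w)
    case Nil
    then show ?case using assms(1) by (simp add: zero_free_group.abs_eq)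
  next
    case (Cons x w)
    then show ?case using assms(2,3) by (cases x) (simp add: abs_Cons)
  qed
qed

subsection \<open>Actions of words\<close>

definition act_word :: "('a \<Rightarrow> 'm \<Rightarrow> 'm) \<Rightarrow> ('a \<Rightarrow> 'm \<Rightarrow> 'm) \<Rightarrow> 'a word \<Rightarrow> 'm \<Rightarrow> 'm" where
  "act_word p p' w = foldr (\<lambda>(a, e). if e then p' a else p a) w"

lemma act_word_simps [simp]:
  "act_word p p' [] m = m"
  "act_word p p' ((a, e) # w) m = (if e then p' a else p a) (act_word p p' w m)"
  "act_word p p' (u @ v) m = act_word p p' u (act_word p p' v m)"
  by (auto simp: act_word_def)

lemma act_word_free_eq:
  assumes "\<And>a m. p a (p' a m) = m" "\<And>a m. p' a (p a m) = m"
  shows "free_eq u v \<Longrightarrow> act_word p p' u m = act_word p p' v m"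
  by (induction rule: free_eq.induct) (auto simp: assms)

text \<open>Independent of the representative only if \<open>p a\<close> and \<open>p' a\<close> are mutually inverse.\<close>

definition free_act :: "('a \<Rightarrow> 'm \<Rightarrow> 'm) \<Rightarrow> ('a \<Rightarrow> 'm \<Rightarrow> 'm) \<Rightarrow> 'a free_group \<Rightarrow> 'm \<Rightarrow> 'm" where
  "free_act p p' w m = act_word p p' (rep_free_group w) m"

lemma free_act_abs:
  assumes "\<And>a m. p a (p' a m) = m" "\<And>a m. p' a (p a m) = m"
  shows "free_act p p' (abs_free_group w) m = act_word p p' w m"
  unfolding free_act_def
  by (rule act_word_free_eq[OF assms]) (rule Quotient_rep_abs[OF Quotient_free_group free_eq.refl])

lemma free_act_simps:
  assumes "\<And>a m. p a (p' a m) = m" "\<And>a m. p' a (p a m) = m"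
  shows "free_act p p' 0 m = m"
    and "free_act p p' (gen a + w) m = p a (free_act p p' w m)"
    and "free_act p p' (- gen a + w) m = p' a (free_act p p' w m)"
proof -
  show "free_act p p' 0 m = m" by (simp add: zero_free_group.abs_eq free_act_abs assms)
  obtain u where w: "w = abs_free_group u" by (metis Quotient_abs_rep[OF Quotient_free_group])
  note abs = free_act_abs[where p = p and p' = p', OF assms]
  have "gen a + w = abs_free_group ((a, False) # u)" "- gen a + w = abs_free_group ((a, True) # u)"
    by (simp_all add: abs_Cons w)
  then show "free_act p p' (gen a + w) m = p a (free_act p p' w m)"
    "free_act p p' (- gen a + w) m = p' a (free_act p p' w m)"
    by (simp_all only: w abs act_word_simps if_True if_False)
qed

definition free_lift :: "('a \<Rightarrow> 'k::group_add) \<Rightarrow> 'a free_group \<Rightarrow> 'k" where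
  "free_lift h w = free_act (\<lambda>a. (+) (h a)) (\<lambda>a. (+) (- h a)) w 0"

lemma free_lift_Cons [simp]:
  "free_lift h 0 = 0"
  "free_lift h (gen a + w) = h a + free_lift h w"
  "free_lift h (- gen a + w) = - h a + free_lift h w"
  by (simp_all add: free_lift_def free_act_simps)

lemma free_lift_add [simp]: "free_lift h (v + w) = free_lift h v + free_lift h w"
  by (induction v rule: free_group_induct) (auto simp: add.assoc)

lemma free_lift_gen [simp]: "free_lift h (gen a) = h a"
  using free_lift_Cons(2)[of h a 0] by simp

lemma free_lift_uminus [simp]: "free_lift h (- w) = - free_lift h w"
  by (metis add.left_inverse free_lift_Cons(1) free_lift_add minus_unique add_eq_0_iff2)

lemma free_lift_unique:
  assumes "\<And>v w. h (v + w) = h v + h w" "\<And>v w. k (v + w) = k v + k w" "\<And>a. h (gen a) = k (gen a)"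
  shows "h w = (k w :: 'k::group_add)"
proof -
  have 0: "h 0 = 0" "k 0 = 0" using assms(1,2)[of 0 0] by (metis add_idem_iff add_0)+
  have "h (- v) = - h v" "k (- v) = - k v" for v
    using assms(1,2)[of "-v" v] 0 by (metis eq_neg_iff_add_eq_0 left_minus)+
  then show ?thesis
    by (induction w rule: free_group_induct) (simp_all add: assms 0)
qed

subsection \<open>Polynomial functions separate the elements of a free group\<close>

definition free_magnus :: "'a free_group \<Rightarrow> (unit, 'a) functional" where
  "free_magnus w = free_act (magnus ()) (magnus_inv ()) w (unit_functional ())"

text \<open>The free group as its free product with the trivial group: one point and one trivial
  letter.\<close>

interpretation free_magnus:
  magnus_group gen "\<lambda>_::unit. 0" "\<lambda>_ s. s" "()" "\<lambda>_. 0" free_magnus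
proof (unfold_locales, goal_cases)
  case (6 P w)
  then show ?case by (induction w rule: free_group_induct) simp_all
qed (simp_all add: free_magnus_def free_act_simps precomp_def fun_eq_iff)

corollary poly_fun_separates_free_group:
  fixes w :: "'a free_group"
  assumes "w \<noteq> 0"
  shows "\<exists>n f. poly_fun n f \<and> f w \<noteq> f 0"
  by (rule free_magnus.poly_fun_separates[OF _ assms]) simp

text \<open>
  Commutators lie in \<open>poly_filt 2\<close>, so this applies to the endomorphisms that act trivially on the
  abelianization.
\<close>

lemma poly_fun_endo:
  fixes h :: "'a free_group \<Rightarrow> 'a free_group"
  assumes hom: "\<And>v w. h (v + w) = h v + h w"
    and triv: "\<And>a. h (gen a) - gen a \<in> poly_filt 2"
  shows "poly_fun (Suc n) f \<Longrightarrow> poly_fun n (\<lambda>x. f (h x) - f x)"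
proof (induction n arbitrary: f)
  case 0
  then have "f (g + x) = f x" for g x by (simp add: diff_by_def)
  from this[of "h x - x" x for x] show ?case by simp
next
  case (Suc n)
  let ?F = "\<lambda>x. f (h x) - f x"
  have gen: "poly_fun n (diff_by (gen a) ?F)" for a
  proof -
    let ?g = "gen a" and ?c = "h (gen a) - gen a"
    have "poly_fun n (diff_by ?c f)" using poly_filtD[OF triv] Suc.prems by simp
    then have "poly_fun n (\<lambda>y. diff_by ?c f (?g + y))" by (rule poly_fun_translate)
    then have 1: "poly_fun n (\<lambda>x. diff_by ?c f (?g + h x))" by (rule poly_fun_hom[OF hom])
    have 2: "poly_fun n (\<lambda>x. diff_by ?g f (h x) - diff_by ?g f x)"
      by (rule Suc.IH) (use Suc.prems in auto)
    \<comment> \<open>Since \<open>h (gen a + x) = ?c + gen a + h x\<close>, the difference splits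
      into one by \<open>?c\<close>, which costs two degrees, and one covered by induction.\<close>
    have "diff_by ?g ?F = (\<lambda>x. diff_by ?c f (?g + h x) + (diff_by ?g f (h x) - diff_by ?g f x))"
      by (auto simp: diff_by_def hom add.assoc[symmetric])
    then show ?thesis using poly_fun_add[OF 1 2] by simp
  qed
  have "poly_fun n (diff_by g ?F)" for g
    by (induction g rule: free_group_induct)
       (auto intro: poly_fun_diff_by_add poly_fun_diff_by_0 poly_fun_diff_by_uminus gen)
  then show ?case by simp
qed

section \<open>An almost direct product of two free groups\<close>

datatype gN = Ga | Gb | Gc
datatype gH = Hs | Ht

type_synonym semi = "gN free_group \<times> gH free_group"

text \<open>
  \<open>Ga, Gb, Gc, Hs, Ht\<close> stand for the elements \<open>a, b, c, s, t\<close>; the flag \<^const>\<open>True\<close> marks inverse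
  letters. Only the left regular action of the five letters on pairs \<open>(m, h)\<close>, read as \<open>m h\<close>, is used,
  not the group structure.
\<close>

definition twist_by :: "gN free_group \<Rightarrow> gN \<Rightarrow> gN free_group \<Rightarrow> gN free_group" where
  "twist_by u c = free_lift (\<lambda>i. if i = c then - u + gen c + u else gen i)"

lemma twist_by_hom [simp]:
  "twist_by u c (v + w) = twist_by u c v + twist_by u c w"
  "twist_by u c (- v) = - twist_by u c v"
  "twist_by u c 0 = 0"
  by (simp_all add: twist_by_def)

lemma twist_by_gen: "twist_by u c (gen i) = (if i = c then - u + gen c + u else gen i)"
  by (simp add: twist_by_def)

lemma twist_by_twist_by:
  assumes "twist_by u c v = v" "u = - v"
  shows "twist_by u c (twist_by v c w) = w"
  by (rule free_lift_unique[where k = "\<lambda>w. w"])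
     (use assms in \<open>auto simp: twist_by_gen add.assoc\<close>)

text \<open>The generator \<open>c\<close> changes by a commutator and the others are fixed, so
  \<open>poly_fun_endo\<close> applies.\<close>

lemma poly_fun_twist_by:
  assumes "poly_fun (Suc n) f"
  shows "poly_fun n (\<lambda>x. f (twist_by u c x) - f x)"
proof (rule poly_fun_endo[OF _ _ assms])
  fix i
  have "- u + gen c - - u - gen c \<in> poly_filt (Suc 0 + Suc 0)"
    by (intro poly_filt_commutator poly_filt_1)
  then show "twist_by u c (gen i) - gen i \<in> poly_filt 2"
    by (simp add: twist_by_gen poly_filt_zero numeral_2_eq_2)
qed simp

fun conj_by :: "gH \<Rightarrow> gN free_group" where
  "conj_by Hs = gen Ga + gen Gb" | "conj_by Ht = gen Gb + gen Gc"

fun moved :: "gH \<Rightarrow> gN" where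
  "moved Hs = Gc" | "moved Ht = Ga"

text \<open>Conjugation by \<open>s\<close> or \<open>t\<close>, or by its inverse. Since
  \<open>conj_by i\<close> avoids the generator \<open>moved i\<close>, it is itself fixed, which
  makes the two flags mutually inverse.\<close>

definition twist :: "gH \<Rightarrow> bool \<Rightarrow> gN free_group \<Rightarrow> gN free_group" where
  "twist i e = twist_by (if e then - conj_by i else conj_by i) (moved i)"

lemma twist_inverse: "twist i e (twist i (\<not> e) w) = w"
  unfolding twist_def by (rule twist_by_twist_by; cases i) (auto simp: twist_by_gen)

lemma twist_hom [simp]: "twist i e (v + w) = twist i e v + twist i e w"
  by (simp add: twist_def)

definition sgn_gen :: "bool \<Rightarrow> 'k::group_add \<Rightarrow> 'k" where
  "sgn_gen e g = (if e then - g else g)"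

text \<open>A letter \<open>s\<close> or \<open>t\<close> multiplied to \<open>m h\<close> from the
  left passes \<open>m\<close> by conjugating it.\<close>

fun semi_act :: "(gN + gH) \<times> bool \<Rightarrow> semi \<Rightarrow> semi" where
  "semi_act (Inl i, e) (m, h) = (sgn_gen e (gen i) + m, h)"
| "semi_act (Inr i, e) (m, h) = (twist i e m, sgn_gen e (gen i) + h)"

lemma semi_act_inverse [simp]:
  "semi_act (y, e) (semi_act (y, \<not> e) p) = p"
  "semi_act (y, True) (semi_act (y, False) p) = p"
  "semi_act (y, False) (semi_act (y, True) p) = p"
proof -
  show *: "semi_act (y, e) (semi_act (y, \<not> e) p) = p" for e
    by (cases y; cases p) (auto simp: sgn_gen_def twist_inverse add.assoc[symmetric])
  show "semi_act (y, True) (semi_act (y, False) p) = p"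
    "semi_act (y, False) (semi_act (y, True) p) = p"
    using *[of True] *[of False] by simp_all
qed

section \<open>The group PV3 as a type\<close>

lemma equivp_pv3_eq: "equivp pv3_eq"
  by (intro equivpI reflpI sympI transpI) (blast intro: pv3_eq.intros)+

lemma pv3_eq_context: "pv3_eq u v \<Longrightarrow> pv3_eq (p @ u @ q) (p @ v @ q)"
proof (induction rule: pv3_eq.induct)
  case (cancel u x v)
  show ?case using pv3_eq.cancel[of "p @ u" x "v @ q"] by simp
next
  case (rel k i j u v)
  then show ?case using pv3_eq.rel[of k i j "p @ u" "v @ q"] by simp
qed (auto intro: pv3_eq.intros)

lemma pv3_eq_append: "pv3_eq u u' \<Longrightarrow> pv3_eq v v' \<Longrightarrow> pv3_eq (u @ v) (u' @ v')"
  using pv3_eq_context[of u u' "[]" v] pv3_eq_context[of v v' u' "[]"] pv3_eq.trans by fastforce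

lemma free_eq_imp_pv3_eq: "free_eq u v \<Longrightarrow> pv3_eq u v"
proof (induction rule: free_eq.induct)
  case (cancel u a e v)
  show ?case using pv3_eq.cancel[of u "(a, e)" v] by (simp add: inv_letter_def)
qed (auto intro: pv3_eq.intros)

lemma inv_word_inv_word [simp]: "inv_word (inv_word w) = w"
  by (induction w) auto

lemma pv3_eq_inverse:
  "pv3_eq (inv_word w @ w) []" "pv3_eq (w @ inv_word w) []"
  using free_eq_left_inverse[of w] free_eq_left_inverse[of "inv_word w"]
  by (auto intro: free_eq_imp_pv3_eq)

text \<open>The clauses of \<open>pv3_eq\<close> contain no inverted relations; instead,
  \<open>v\<close> is exchanged for \<open>u\<close> inside
  \<open>inv_word u @ v @ inv_word v\<close>.\<close>

lemma pv3_eq_inv_word: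
  assumes "pv3_eq u v"
  shows "pv3_eq (inv_word u) (inv_word v)"
proof -
  have "pv3_eq (inv_word u @ v @ inv_word v) (inv_word u @ u @ inv_word v)"
    by (rule pv3_eq_context) (rule pv3_eq.sym, rule assms)
  moreover have "pv3_eq (inv_word u @ v @ inv_word v) (inv_word u)"
    using pv3_eq_context[OF pv3_eq_inverse(2), of "inv_word u" v "[]"] by simp
  moreover have "pv3_eq (inv_word u @ u @ inv_word v) (inv_word v)"
    using pv3_eq_context[OF pv3_eq_inverse(1), of "[]" u "inv_word v"] by simp
  ultimately show ?thesis by (blast intro: pv3_eq.sym pv3_eq.trans)
qed

quotient_type pv3 = "letter list" / pv3_eq
  by (rule equivp_pv3_eq)

instantiation pv3 :: group_add
begin

lift_definition zero_pv3 :: pv3 is "[]" .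
lift_definition plus_pv3 :: "pv3 \<Rightarrow> pv3 \<Rightarrow> pv3" is "(@)"
  by (rule pv3_eq_append)
lift_definition uminus_pv3 :: "pv3 \<Rightarrow> pv3" is inv_word
  by (rule pv3_eq_inv_word)
definition minus_pv3 :: "pv3 \<Rightarrow> pv3 \<Rightarrow> pv3" where
  "minus_pv3 u v = u + - v"

instance
proof
  fix u v w :: pv3
  show "u + v + w = u + (v + w)" by transfer (simp add: pv3_eq.refl)
  show "0 + u = u" by transfer (simp add: pv3_eq.refl)
  show "u + 0 = u" by transfer (simp add: pv3_eq.refl)
  show "- u + u = 0" by transfer (rule pv3_eq_inverse)
  show "u + - v = u - v" by (simp add: minus_pv3_def)
qed

end

lift_definition pgen :: "gen \<Rightarrow> pv3" is "\<lambda>g. [(g, False)]" .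

lemma abs_pv3_Cons: "abs_pv3 ((g, e) # w) = (if e then - pgen g else pgen g) + abs_pv3 w"
proof -
  have "abs_pv3 ((g, e) # w) = abs_pv3 [(g, e)] + abs_pv3 w"
    by (simp add: plus_pv3.abs_eq)
  moreover have "abs_pv3 [(g, e)] = (if e then - pgen g else pgen g)"
    by (auto simp: pgen.abs_eq uminus_pv3.abs_eq)
  ultimately show ?thesis by simp
qed

lemma pv3_induct [case_names zero gen inv]:
  assumes "P 0" "\<And>g w. P w \<Longrightarrow> P (pgen g + w)" "\<And>g w. P w \<Longrightarrow> P (- pgen g + w)"
  shows "P w"
proof (induction w rule: pv3.abs_induct)
  case (1 w)
  show ?case
  proof (induction w)
    case Nil
    then show ?case using assms(1) by (simp add: zero_pv3.abs_eq)
  next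
    case (Cons x w)
    then show ?case using assms(2,3) by (cases x) (simp add: abs_pv3_Cons)
  qed
qed

lemma pgen_rel:
  assumes "distinct [k, i, j]"
  shows "pgen (lam k i) + (pgen (lam k j) + pgen (lam i j)) = pgen (lam i j) + (pgen (lam k j) + pgen (lam k i))"
proof -
  have "pv3_eq ([] @ [pos (lam k i), pos (lam k j), pos (lam i j)] @ [])
               ([] @ [pos (lam i j), pos (lam k j), pos (lam k i)] @ [])"
    by (rule pv3_eq.rel) (rule assms)
  then show ?thesis
    by (simp add: pgen.abs_eq plus_pv3.abs_eq pos_def pv3.abs_eq_iff)
qed

definition pv3_act :: "(gen \<Rightarrow> 'm \<Rightarrow> 'm) \<Rightarrow> (gen \<Rightarrow> 'm \<Rightarrow> 'm) \<Rightarrow> pv3 \<Rightarrow> 'm \<Rightarrow> 'm" where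
  "pv3_act p p' w m = act_word p p' (rep_pv3 w) m"

lemma act_word_pv3_eq:
  assumes inv: "\<And>g m. p g (p' g m) = m" "\<And>g m. p' g (p g m) = m"
    and rel: "\<And>k i j m. distinct [k, i, j] \<Longrightarrow>
      p (lam k i) (p (lam k j) (p (lam i j) m)) = p (lam i j) (p (lam k j) (p (lam k i) m))"
  shows "pv3_eq u v \<Longrightarrow> act_word p p' u m = act_word p p' v m"
proof (induction rule: pv3_eq.induct)
  case (cancel u x v)
  show ?case by (cases x) (simp add: inv_letter_def inv)
next
  case (rel k i j u v)
  then show ?case using assms(3)[of k i j] by (simp add: pos_def)
qed auto

lemma pv3_act_simps:
  assumes inv: "\<And>g m. p g (p' g m) = m" "\<And>g m. p' g (p g m) = m"
    and rel: "\<And>k i j m. distinct [k, i, j] \<Longrightarrow>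
      p (lam k i) (p (lam k j) (p (lam i j) m)) = p (lam i j) (p (lam k j) (p (lam k i) m))"
  shows "pv3_act p p' 0 m = m"
    and "pv3_act p p' (pgen g + w) m = p g (pv3_act p p' w m)"
    and "pv3_act p p' (- pgen g + w) m = p' g (pv3_act p p' w m)"
proof -
  have abs: "pv3_act p p' (abs_pv3 w) m = act_word p p' w m" for w m
    unfolding pv3_act_def
    by (rule act_word_pv3_eq[where p = p and p' = p', OF assms]) (auto intro: Quotient_rep_abs[OF Quotient_pv3 pv3_eq.refl])
  show "pv3_act p p' 0 m = m" by (simp add: zero_pv3.abs_eq abs)
  obtain u where w: "w = abs_pv3 u" by (metis Quotient_abs_rep[OF Quotient_pv3])
  have "pgen g + w = abs_pv3 ((g, False) # u)" "- pgen g + w = abs_pv3 ((g, True) # u)"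
    by (simp_all add: abs_pv3_Cons w)
  then show "pv3_act p p' (pgen g + w) m = p g (pv3_act p p' w m)"
    "pv3_act p p' (- pgen g + w) m = p' g (pv3_act p p' w m)"
    by (simp_all only: w abs act_word_simps if_True if_False)
qed

section \<open>The free product decomposition\<close>

fun pN :: "gN \<Rightarrow> pv3" where
  "pN Ga = pgen L12 + pgen L13" | "pN Gb = pgen L23 + pgen L21" | "pN Gc = pgen L31 + pgen L32"

fun pH :: "gH \<Rightarrow> pv3" where
  "pH Hs = - (pgen L23 + pgen L13)" | "pH Ht = - (pgen L31 + pgen L21)"

lemmas group_norm = add.assoc minus_add diff_conv_add_uminus

text \<open>Multiply the relation by \<open>y\<close> on the right, respectively on the
  left.\<close>

lemma commute_of_rel:
  fixes x y z :: "'k::group_add"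
  assumes "x + (y + z) = z + (y + x)"
  shows "(x + y) + (z + y) = (z + y) + (x + y)" "(y + x) + (y + z) = (y + z) + (y + x)"
  using assms by (metis add.assoc)+

text \<open>Cancelling \<open>t\<close>, which commutes with \<open>c\<close>, leaves
  \<open>c\<close> commuting with \<open>a s b = a b s\<close>; solve for the conjugate by
  \<open>s\<close>.\<close>

lemma conj_of_commute:
  fixes a b c s t :: "'k::group_add"
  assumes sa: "s + a = a + s" and sb: "s + b = b + s" and tc: "t + c = c + t"
    and c: "c + (a + s + b + t + c) = (a + s + b + t + c) + c"
  shows "s + c - s = - (a + b) + c + (a + b)"
proof -
  have "c + (a + s + b + t) = a + s + b + (t + c)"
    using c by (simp add: add.assoc[symmetric])
  then have "c + (a + s + b) + t = a + s + b + c + t"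
    by (simp add: tc add.assoc)
  then have "c + (a + s + b) = a + s + b + c" by simp
  moreover have "a + s + b = a + b + s" using sb by (simp add: add.assoc)
  ultimately have "c + (a + b + s) = a + b + s + c" by simp
  then have "s + c = - (a + b) + c + (a + b) + s"
    by (metis add.assoc minus_add_cancel)
  then show ?thesis by simp
qed

text \<open>As \<open>a\<close> commutes with \<open>s\<close>, it also commutes with
  \<open>b t c = b c t\<close>.\<close>

lemma conj_of_commute':
  fixes a b c s t :: "'k::group_add"
  assumes sa: "s + a = a + s" and tc: "t + c = c + t"
    and a: "a + (a + s + b + t + c) = (a + s + b + t + c) + a"
  shows "t + a - t = - (b + c) + a + (b + c)"
proof -
  have "a + (s + a + (b + t + c)) = (a + s) + ((b + t + c) + a)"
    using a unfolding sa by (simp only: add.assoc)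
  then have "(a + s) + (a + (b + t + c)) = (a + s) + ((b + t + c) + a)"
    by (simp only: add.assoc)
  then have "a + (b + t + c) = b + t + c + a" by simp
  moreover have "b + t + c = b + c + t" using tc by (simp add: add.assoc)
  ultimately have "a + (b + c + t) = b + c + t + a" by simp
  then have "t + a = - (b + c) + a + (b + c) + t"
    by (metis add.assoc minus_add_cancel)
  then show ?thesis by simp
qed

lemma commute_uminus:
  fixes x y :: "'k::group_add"
  assumes "x + y = y + x"
  shows "- x + y = y + - x"
proof -
  have "y + - x = - x + ((x + y) + - x)" by (simp only: add.assoc minus_add_cancel)
  also have "\<dots> = - x + y" unfolding assms by (simp only: add.assoc right_minus add_0_right)
  finally show ?thesis by (rule HOL.sym)
qed

text \<open>Each line is one defining relation, for the orderings 123, 213, 231 and 321 in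
  turn.\<close>

lemma pN_pH_commute:
  "pH Hs + pN Ga = pN Ga + pH Hs" "pH Hs + pN Gb = pN Gb + pH Hs"
  "pH Ht + pN Gb = pN Gb + pH Ht" "pH Ht + pN Gc = pN Gc + pH Ht"
proof -
  note r = commute_of_rel[OF pgen_rel[of I1 I2 I3, simplified]]
    commute_of_rel[OF pgen_rel[of I2 I1 I3, simplified]]
    commute_of_rel[OF pgen_rel[of I2 I3 I1, simplified]]
    commute_of_rel[OF pgen_rel[of I3 I2 I1, simplified]]
  show "pH Hs + pN Ga = pN Ga + pH Hs" "pH Hs + pN Gb = pN Gb + pH Hs"
    "pH Ht + pN Gb = pN Gb + pH Ht" "pH Ht + pN Gc = pN Gc + pH Ht"
    unfolding pN.simps pH.simps by (rule commute_uminus, rule r r[symmetric])+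
qed

text \<open>The product telescopes. Through it the two remaining relations, for 312 and 132, say
  that \<open>c\<close> and \<open>a\<close> commute with \<open>a s b t c\<close>.\<close>

lemma prod_all: "pN Ga + pH Hs + pN Gb + pH Ht + pN Gc = pgen L12 + pgen L32"
  by (simp add: group_norm del: add_uminus_conv_diff)

lemma pN_prod_commute:
  "pN Gc + (pgen L12 + pgen L32) = (pgen L12 + pgen L32) + pN Gc"
  "pN Ga + (pgen L12 + pgen L32) = (pgen L12 + pgen L32) + pN Ga"
  using commute_of_rel[OF pgen_rel[of I3 I1 I2, simplified]]
    commute_of_rel[OF pgen_rel[of I1 I3 I2, simplified]] by simp_all

lemma pH_conj:
  "pH Hs + pN Gc - pH Hs = - (pN Ga + pN Gb) + pN Gc + (pN Ga + pN Gb)"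
  "pH Ht + pN Ga - pH Ht = - (pN Gb + pN Gc) + pN Ga + (pN Gb + pN Gc)"
  by (rule conj_of_commute[OF pN_pH_commute(1,2,4)], simp only: prod_all pN_prod_commute)
     (rule conj_of_commute'[OF pN_pH_commute(1,4)], simp only: prod_all pN_prod_commute)

lemma lift_twist_False: "free_lift pN (twist i False m) = pH i + free_lift pN m - pH i"
proof (rule free_lift_unique[where h = "\<lambda>m. free_lift pN (twist i False m)"])
  fix k
  have "x + y = y + x \<Longrightarrow> y = x + y - x" for x y :: pv3 by simp
  then show "free_lift pN (twist i False (gen k)) = pH i + free_lift pN (gen k) - pH i"
    using pH_conj pN_pH_commute
    by (cases i; cases k) (simp_all del: pN.simps pH.simps add: twist_def twist_by_gen)
qed (simp_all add: group_norm del: add_uminus_conv_diff)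

lemma lift_twist: "sgn_gen e (pH i) + free_lift pN m = free_lift pN (twist i e m) + sgn_gen e (pH i)"
proof (cases e)
  case True
  have "free_lift pN m = pH i + free_lift pN (twist i True m) - pH i"
    using lift_twist_False[of i "twist i True m"] twist_inverse[of i False m] by simp
  then show ?thesis using True by (simp add: sgn_gen_def group_norm del: add_uminus_conv_diff)
next
  case False
  then show ?thesis by (simp add: sgn_gen_def lift_twist_False)
qed

fun pY :: "(gN + gH) \<times> bool \<Rightarrow> pv3" where
  "pY (Inl i, e) = sgn_gen e (pN i)" | "pY (Inr i, e) = sgn_gen e (pH i)"

fun pv3_of_semi :: "semi \<Rightarrow> pv3" where
  "pv3_of_semi (m, h) = free_lift pN m + free_lift pH h"

lemma pv3_of_semi_act: "pv3_of_semi (semi_act y p) = pY y + pv3_of_semi p"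
proof (cases y; cases p; cases "fst y")
  fix i' e m h i assume "y = (i', e)" "p = (m, h)" "fst y = Inl i"
  then show ?thesis by (simp add: sgn_gen_def add.assoc)
next
  fix i' e m h i assume *: "y = (i', e)" "p = (m, h)" "fst y = Inr i"
  have "free_lift pH (sgn_gen e (gen i) + h) = sgn_gen e (pH i) + free_lift pH h"
    by (simp add: sgn_gen_def)
  then show ?thesis using * lift_twist[of e i m] by (simp add: add.assoc[symmetric])
qed

section \<open>The action of \<open>pv3\<close> on Magnus functionals\<close>

abbreviation base :: semi where "base \<equiv> (0, 0)"

type_synonym pv3_functional = "(semi, unit) functional"

definition opN :: "gN \<Rightarrow> bool \<Rightarrow> pv3_functional \<Rightarrow> pv3_functional" where
  "opN i e = precomp (semi_act (Inl i, e))"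

definition opH :: "gH \<Rightarrow> bool \<Rightarrow> pv3_functional \<Rightarrow> pv3_functional" where
  "opH i e = precomp (semi_act (Inr i, e))"

abbreviation "opX \<equiv> (magnus base () :: pv3_functional \<Rightarrow> pv3_functional)"
abbreviation "opX' \<equiv> (magnus_inv base () :: pv3_functional \<Rightarrow> pv3_functional)"

lemma op_cancel [simp]:
  "opN i True (opN i False \<phi>) = \<phi>" "opN i False (opN i True \<phi>) = \<phi>"
  "opH j True (opH j False \<phi>) = \<phi>" "opH j False (opH j True \<phi>) = \<phi>"
  by (simp_all add: opN_def opH_def precomp_precomp comp_def)

text \<open>
  Obtained by solving for the generators: \<open>\<lambda>13\<close> is \<open>x\<close> inverse times \<open>a\<close>, \<open>\<lambda>21\<close> is \<open>x\<close> inverse times \<open>a s b\<close>,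
  and so on.
\<close>

fun pv3_op :: "gen \<Rightarrow> pv3_functional \<Rightarrow> pv3_functional" where
  "pv3_op L12 \<phi> = opX \<phi>"
| "pv3_op L13 \<phi> = opX' (opN Ga False \<phi>)"
| "pv3_op L23 \<phi> = opH Hs True (opN Ga True (opX \<phi>))"
| "pv3_op L21 \<phi> = opX' (opN Ga False (opH Hs False (opN Gb False \<phi>)))"
| "pv3_op L31 \<phi> = opH Ht True (opN Gb True (opH Hs True (opN Ga True (opX \<phi>))))"
| "pv3_op L32 \<phi> = opX' (opN Ga False (opH Hs False (opN Gb False (opH Ht False (opN Gc False \<phi>)))))"

fun pv3_op_inv :: "gen \<Rightarrow> pv3_functional \<Rightarrow> pv3_functional" where
  "pv3_op_inv L12 \<phi> = opX' \<phi>"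
| "pv3_op_inv L13 \<phi> = opN Ga True (opX \<phi>)"
| "pv3_op_inv L23 \<phi> = opX' (opN Ga False (opH Hs False \<phi>))"
| "pv3_op_inv L21 \<phi> = opN Gb True (opH Hs True (opN Ga True (opX \<phi>)))"
| "pv3_op_inv L31 \<phi> = opX' (opN Ga False (opH Hs False (opN Gb False (opH Ht False \<phi>))))"
| "pv3_op_inv L32 \<phi> = opN Gc True (opH Ht True (opN Gb True (opH Hs True (opN Ga True (opX \<phi>)))))"

lemma pv3_op_inverse: "pv3_op g (pv3_op_inv g \<phi>) = \<phi>" "pv3_op_inv g (pv3_op g \<phi>) = \<phi>"
  by (cases g; simp)+

lemma twist_uminus [simp]: "twist i e (- m) = - twist i e m"
  by (simp add: twist_def)

lemma twist_gen:
  "twist i e (gen k) = (if k = moved i then - sgn_gen e (conj_by i) + gen k + sgn_gen e (conj_by i) else gen k)"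
  by (simp add: twist_def twist_by_gen sgn_gen_def)

text \<open>The identities to which the six relations reduce once adjacent \<open>opX\<close> and
  \<open>opX'\<close> cancel. Both sides are precompositions, so it suffices to compare maps on
  pairs.\<close>

lemma op_rel:
  "opN Ga False (opH Hs True (opN Ga True \<phi>)) = opH Hs True \<phi>"
  "opH Hs False (opN Gb False (opH Hs True \<phi>)) = opN Gb False \<phi>"
  "opN Gb False (opH Ht True (opN Gb True \<phi>)) = opH Ht True \<phi>"
  "opN Gb True (opH Hs True (opN Gb False \<phi>)) = opH Hs True \<phi>"
  "opH Ht False (opN Gc False (opH Ht True \<phi>)) = opN Gc False \<phi>"
  "opN Ga False (opH Hs False (opN Gb False (opN Gc False (opN Gb True (opH Hs True (opN Ga True \<phi>)))))) =
     opN Gc False \<phi>"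
  "opN Ga False (opH Hs False (opN Gb False (opH Ht False (opN Gc False (opN Ga False \<phi>))))) =
     opN Ga False (opN Ga False (opH Hs False (opN Gb False (opH Ht False (opN Gc False \<phi>)))))"
proof -
  have twist_cancel: "twist i False (twist i True m) = m" "twist i True (twist i False m) = m" for i m
    using twist_inverse[of i False m] twist_inverse[of i True m] by simp_all
  have *: "g = h \<Longrightarrow> precomp g \<phi> = precomp h \<phi>" for g h :: "semi \<Rightarrow> semi" by simp
  show
    "opN Ga False (opH Hs True (opN Ga True \<phi>)) = opH Hs True \<phi>"
    "opH Hs False (opN Gb False (opH Hs True \<phi>)) = opN Gb False \<phi>"
    "opN Gb False (opH Ht True (opN Gb True \<phi>)) = opH Ht True \<phi>"
    "opN Gb True (opH Hs True (opN Gb False \<phi>)) = opH Hs True \<phi>"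
  "opH Ht False (opN Gc False (opH Ht True \<phi>)) = opN Gc False \<phi>"
    "opN Ga False (opH Hs False (opN Gb False (opN Gc False (opN Gb True (opH Hs True (opN Ga True \<phi>)))))) =
       opN Gc False \<phi>"
    "opN Ga False (opH Hs False (opN Gb False (opH Ht False (opN Gc False (opN Ga False \<phi>))))) =
       opN Ga False (opN Ga False (opH Hs False (opN Gb False (opH Ht False (opN Gc False \<phi>)))))"
    unfolding opN_def opH_def precomp_precomp
    by (rule *, simp add: fun_eq_iff sgn_gen_def twist_gen twist_cancel group_norm
        del: add_uminus_conv_diff)+
qed

lemma pv3_op_rel:
  assumes "distinct [k, i, j]"
  shows "pv3_op (lam k i) (pv3_op (lam k j) (pv3_op (lam i j) \<phi>)) =
    pv3_op (lam i j) (pv3_op (lam k j) (pv3_op (lam k i) \<phi>))"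
  using assms by (cases k; cases i; cases j) (simp_all add: op_rel)

definition pv3_magnus :: "pv3 \<Rightarrow> pv3_functional" where
  "pv3_magnus w = pv3_act pv3_op pv3_op_inv w (unit_functional base)"

lemma pv3_magnus_simps:
  "pv3_magnus 0 = unit_functional base"
  "pv3_magnus (pgen g + w) = pv3_op g (pv3_magnus w)"
  "pv3_magnus (- pgen g + w) = pv3_op_inv g (pv3_magnus w)"
  unfolding pv3_magnus_def by (rule pv3_act_simps; (rule pv3_op_inverse | erule pv3_op_rel))+

lemma pv3_magnus_Y: "pv3_magnus (pY y + w) = precomp (semi_act y) (pv3_magnus w)"
proof -
  have "pv3_magnus (sgn_gen e (pN i) + w) = opN i e (pv3_magnus w)" for e i
    by (cases i; cases e) (simp_all add: sgn_gen_def pv3_magnus_simps group_norm del: add_uminus_conv_diff)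
  moreover have "pv3_magnus (sgn_gen e (pH i) + w) = opH i e (pv3_magnus w)" for e i
    by (cases i; cases e) (simp_all add: sgn_gen_def pv3_magnus_simps group_norm del: add_uminus_conv_diff)
  ultimately show ?thesis by (cases y rule: pY.cases) (simp_all add: opN_def opH_def)
qed

lemma pv3_generated:
  assumes P0: "P 0" and PY: "\<And>y w. P w \<Longrightarrow> P (pY y + w)"
    and PX: "\<And>w. P w \<Longrightarrow> P (pgen L12 + w)" and PX': "\<And>w. P w \<Longrightarrow> P (- pgen L12 + w)"
  shows "P w"
proof -
  have N: "P (sgn_gen e (pN i) + w)" and H: "P (sgn_gen e (pH j) + w)" if "P w" for e i j w
    using PY[OF that, of "(Inl i, e)"] PY[OF that, of "(Inr j, e)"] by simp_all
  \<comment> \<open>The same words as in \<open>pv3_op\<close> and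
    \<open>pv3_op_inv\<close>.\<close>
  have letters: "pgen L13 + w = - pgen L12 + (pN Ga + w)"
    "pgen L23 + w = - pH Hs + (- pN Ga + (pgen L12 + w))"
    "pgen L21 + w = - pgen L12 + (pN Ga + (pH Hs + (pN Gb + w)))"
    "pgen L31 + w = - pH Ht + (- pN Gb + (- pH Hs + (- pN Ga + (pgen L12 + w))))"
    "pgen L32 + w = - pgen L12 + (pN Ga + (pH Hs + (pN Gb + (pH Ht + (pN Gc + w)))))"
    "- pgen L13 + w = - pN Ga + (pgen L12 + w)"
    "- pgen L23 + w = - pgen L12 + (pN Ga + (pH Hs + w))"
    "- pgen L21 + w = - pN Gb + (- pH Hs + (- pN Ga + (pgen L12 + w)))"
    "- pgen L31 + w = - pgen L12 + (pN Ga + (pH Hs + (pN Gb + (pH Ht + w))))"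
    "- pgen L32 + w = - pN Gc + (- pH Ht + (- pN Gb + (- pH Hs + (- pN Ga + (pgen L12 + w)))))"
    for w
    by (simp_all add: group_norm del: add_uminus_conv_diff)
  have N': "P w \<Longrightarrow> P (pN i + w)" "P w \<Longrightarrow> P (- pN i + w)" for i w
    using N[of w False i] N[of w True i] by (simp_all add: sgn_gen_def)
  have H': "P w \<Longrightarrow> P (pH i + w)" "P w \<Longrightarrow> P (- pH i + w)" for i w
    using H[of w False i] H[of w True i] by (simp_all add: sgn_gen_def)
  show ?thesis
  proof (induction w rule: pv3_induct)
    case (gen g w)
    then show ?case
      by (cases g) (simp_all only: letters N' H' PX PX')
  next
    case (inv g w)
    then show ?case
      by (cases g) (simp_all only: letters N' H' PX PX')
  qed (rule P0)
qed

text \<open>The single free letter is \<open>x\<close>; the factor is the semidirect product, seen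
  through its action on \<open>semi\<close>.\<close>

interpretation pv3: magnus_group "\<lambda>_::unit. pgen L12" pY semi_act base pv3_of_semi pv3_magnus
proof (unfold_locales, goal_cases)
  case (2 y s)
  show ?case by (rule pv3_of_semi_act)
next
  case (4 y w)
  show ?case by (rule pv3_magnus_Y)
next
  case (6 P w)
  show ?case by (rule pv3_generated) (rule 6; assumption)+
qed (simp_all add: pv3_magnus_simps)

text \<open>Letters from \<open>gN\<close> translate the first coordinate; those from
  \<open>gH\<close> twist it, which lowers degree because twists are trivial on the
  abelianization.\<close>

lemma poly_on_fst: "poly_fun n f \<Longrightarrow> pv3.poly_on n (\<lambda>p. f (fst p))"
proof (induction n arbitrary: f)
  case (Suc n)
  have "poly_fun n (\<lambda>m. f (twist i e m) - f m)" for i e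
    unfolding twist_def by (rule poly_fun_twist_by) (rule Suc.prems)
  then have H: "pv3.poly_on n (\<lambda>p. f (twist i e (fst p)) - f (fst p))" for i e
    by (rule Suc.IH)
  have N: "pv3.poly_on n (\<lambda>p. diff_by g f (fst p))" for g
    using Suc by simp
  show ?case
  proof (simp, intro allI)
    fix i e
    show "pv3.poly_on n (\<lambda>s. f (fst (semi_act (i, e) s)) - f (fst s))"
    proof (cases i)
      case (Inl j)
      have "(\<lambda>s. f (fst (semi_act (i, e) s)) - f (fst s)) = (\<lambda>p. diff_by (sgn_gen e (gen j)) f (fst p))"
        using Inl by (auto simp: diff_by_def)
      then show ?thesis using N by simp
    next
      case (Inr j)
      have "(\<lambda>s. f (fst (semi_act (i, e) s)) - f (fst s)) = (\<lambda>p. f (twist j e (fst p)) - f (fst p))"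
        using Inr by auto
      then show ?thesis using H by simp
    qed
  qed
qed simp

lemma poly_on_snd: "poly_fun n f \<Longrightarrow> pv3.poly_on n (\<lambda>p. f (snd p))"
proof (induction n arbitrary: f)
  case (Suc n)
  have H: "pv3.poly_on n (\<lambda>p. diff_by g f (snd p))" for g
    using Suc by simp
  have Z: "pv3.poly_on n (\<lambda>p. 0)"
    using Suc.IH[OF poly_fun_zero] .
  show ?case
  proof (simp, intro allI)
    fix i e
    show "pv3.poly_on n (\<lambda>s. f (snd (semi_act (i, e) s)) - f (snd s))"
    proof (cases i)
      case (Inl j)
      have "(\<lambda>s. f (snd (semi_act (i, e) s)) - f (snd s)) = (\<lambda>p. 0)"
        using Inl by auto
      then show ?thesis using Z by simp
    next
      case (Inr j)
      have "(\<lambda>s. f (snd (semi_act (i, e) s)) - f (snd s)) = (\<lambda>p. diff_by (sgn_gen e (gen j)) f (snd p))"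
        using Inr by (auto simp: diff_by_def)
      then show ?thesis using H by simp
    qed
  qed
qed simp

lemma poly_fun_shift:
  fixes w :: "'k::group_add"
  assumes "poly_fun n f" "f w \<noteq> f 0"
  shows "\<exists>n h. poly_fun n h \<and> h 0 = 0 \<and> h w \<noteq> 0"
proof -
  \<comment> \<open>Constants satisfy \<open>poly_fun 1\<close>, so \<open>Suc n\<close>
    accommodates them for every \<open>n\<close>.\<close>
  have "poly_fun (Suc n) (\<lambda>x::'k. f 0)"
    by (simp add: diff_by_def[abs_def] poly_fun_zero)
  then have "poly_fun (Suc n) (\<lambda>x. f x - f 0)"
    by (rule poly_fun_diff[OF poly_fun_Suc[OF assms(1)]])
  then show ?thesis using assms(2)
    by (intro exI[of _ "Suc n"] exI[of _ "\<lambda>x. f x - f 0"]) simp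
qed

theorem poly_fun_separates_pv3:
  assumes "w \<noteq> 0"
  shows "\<exists>n f. poly_fun n f \<and> f (w::pv3) \<noteq> f 0"
proof (rule pv3.poly_fun_separates[OF _ assms])
  fix s :: semi assume "s \<noteq> base"
  obtain m h where s: "s = (m, h)" by (cases s)
  with \<open>s \<noteq> base\<close> consider "m \<noteq> 0" | "h \<noteq> 0" by auto
  then show "\<exists>n f. pv3.poly_on n f \<and> f base = 0 \<and> f s \<noteq> 0"
  proof cases
    case 1
    then obtain n f where f: "poly_fun n f" "f 0 = 0" "f m \<noteq> 0"
      using poly_fun_separates_free_group poly_fun_shift by meson
    then show ?thesis using poly_on_fst[OF f(1)] s by force
  next
    case 2
    then obtain n f where f: "poly_fun n f" "f 0 = 0" "f h \<noteq> 0"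
      using poly_fun_separates_free_group poly_fun_shift by meson
    then show ?thesis using poly_on_snd[OF f(1)] s by force
  qed
qed

section \<open>Back to \<^const>\<open>PV3\<close>\<close>

lemma equiv_pv3_rel: "equiv UNIV pv3_rel"
  unfolding pv3_rel_def
  by (intro equivI refl_onI symI transI) (auto intro: pv3_eq.intros)

definition cls :: "letter list \<Rightarrow> letter list set" where
  "cls w = pv3_rel `` {w}"

lemma cls_eq_iff: "cls u = cls v \<longleftrightarrow> pv3_eq u v"
  unfolding cls_def using eq_equiv_class_iff[OF equiv_pv3_rel] by (simp add: pv3_rel_def)

lemma carrier_PV3: "carrier PV3 = range cls"
  by (auto simp: PV3_def quotient_def cls_def)

lemma some_cls: "pv3_eq w (SOME a. a \<in> cls w)"
proof -
  have "w \<in> cls w" by (simp add: cls_def pv3_rel_def pv3_eq.refl)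
  then have "(SOME a. a \<in> cls w) \<in> cls w" by (rule someI)
  then show ?thesis by (simp add: cls_def pv3_rel_def)
qed

lemma mult_PV3: "cls u \<otimes>\<^bsub>PV3\<^esub> cls v = cls (u @ v)"
proof -
  have "cls u \<otimes>\<^bsub>PV3\<^esub> cls v = cls ((SOME a. a \<in> cls u) @ (SOME b. b \<in> cls v))"
    by (simp add: PV3_def cls_def)
  also have "\<dots> = cls (u @ v)"
    unfolding cls_eq_iff by (rule pv3_eq.sym, rule pv3_eq_append) (rule some_cls)+
  finally show ?thesis .
qed

lemma one_PV3: "\<one>\<^bsub>PV3\<^esub> = cls []"
  by (simp add: PV3_def cls_def)

lemma group_PV3: "group PV3"
proof (rule groupI)
  fix x assume "x \<in> carrier PV3"
  then obtain u where "x = cls u" by (auto simp: carrier_PV3)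
  then have "cls (inv_word u) \<otimes>\<^bsub>PV3\<^esub> x = \<one>\<^bsub>PV3\<^esub>"
    by (simp add: mult_PV3 one_PV3 cls_eq_iff pv3_eq_inverse)
  then show "\<exists>y\<in>carrier PV3. y \<otimes>\<^bsub>PV3\<^esub> x = \<one>\<^bsub>PV3\<^esub>" by (auto simp: carrier_PV3)
qed (auto simp: carrier_PV3 mult_PV3 one_PV3)

text \<open>Carries the classes of \<open>PV3\<close> to the type \<open>pv3\<close>, on which the
  polynomial functions live.\<close>

definition pv3_of_class :: "letter list set \<Rightarrow> pv3" where
  "pv3_of_class A = abs_pv3 (SOME a. a \<in> A)"

lemma pv3_of_class_cls: "pv3_of_class (cls w) = abs_pv3 w"
  unfolding pv3_of_class_def pv3.abs_eq_iff by (rule pv3_eq.sym) (rule some_cls)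

theorem theorem2p2:
  shows "group PV3 \<and> residually_tf_nilpotent PV3"
proof
  show "group PV3" by (rule group_PV3)
  show "residually_tf_nilpotent PV3"
  proof (rule group.residually_tf_nilpotent_by_poly_fun[OF group_PV3, where \<rho> = pv3_of_class])
    show "inj_on pv3_of_class (carrier PV3)"
      by (auto simp: inj_on_def carrier_PV3 pv3_of_class_cls pv3.abs_eq_iff cls_eq_iff)
  next
    fix x y assume "x \<in> carrier PV3" "y \<in> carrier PV3"
    then show "pv3_of_class (x \<otimes>\<^bsub>PV3\<^esub> y) = pv3_of_class x + pv3_of_class y"
      by (auto simp: carrier_PV3 mult_PV3 pv3_of_class_cls plus_pv3.abs_eq)
  qed (rule poly_fun_separates_pv3)
qed

end
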